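(* Every family of hyperbolic uniform disk graphs with clique number and disk radius in $O(1)$ admits product structure. In contrast, for every super-constant function $r=r(n)$ (i.e. $r(n)\to\infty$ as $n\to\infty$), there are families of hyperbolic uniform disk graphs with constant clique number (clique number in $O(1)$) and disk radius in $\Theta(r)$ not admitting product structure.
   Context: Graphs are finite and simple. For $r>0$, a graph $G$ is a hyperbolic uniform disk graph (HUDG) with disk radius $r$ if it is the intersection graph of (closed) disks of radius $r$ in the hyperbolic plane (of curvature $-1$); equivalently, vertices are assigned to points of the hyperbolic plane and two distinct vertices are adjacent if and only if their points have hyperbolic distance at most $2r$. The clique number is the number of vertices of a largest complete subgraph. Asymptotics are with respect to the number $n$ of vertices: a family $\mathcal G$ of HUDGs has disk radius in $\Theta(r(n))$ if there are constants $c_1,c_2>0$ such that every sufficiently large $n$-vertex graph $G\in\mathcal G$ is a HUDG with some disk radius $r_G$ satisfying $c_1 r(n)\le r_G\le c_2 r(n)$; disk radius in $O(1)$ and clique number in $O(1)$ are defined analogously. The strong product $G\boxtimes H$ has vertex set $V(G)\times V(H)$, and two distinct vertices $(u_G,u_H)$, $(v_G,v_H)$ are adjacent if and only if ($u_G=v_G$ or $u_Gv_G\in E(G)$) and ($u_H=v_H$ or $u_Hv_H\in E(H)$). The row-treewidth of $G$ is the smallest $t$ such that $G$ is (isomorphic to) a subgraph of $H\boxtimes P$ for some graph $H$ of treewidth $t$ and some path $P$. A graph family admits product structure if there is a constant upper-bounding the row-treewidth of all its members. *)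

theory Defs
  imports Complex_Main "Graph_Theory.Graph_Theory"
begin

text \<open>
  A finite simple graph is a \<^typ>\<open>'a pair_pre_digraph\<close> satisfying \<^locale>\<open>pair_graph\<close> (finite,
  loop-free, symmetric, no parallel arcs): an edge \<open>uv\<close> is the pair of arcs \<open>(u,v)\<close>, \<open>(v,u)\<close>.
  The order of a graph is \<open>card (pverts G)\<close>.
\<close>

section \<open>Hyperbolic uniform disk graphs\<close>

text \<open>The Poincare half-plane model of the hyperbolic plane of curvature \<open>-1\<close>.\<close>

definition upper_half_plane :: "complex set" where
  "upper_half_plane = {z. Im z > 0}"

definition hyp_dist :: "complex \<Rightarrow> complex \<Rightarrow> real" where
  "hyp_dist z w = arcosh (1 + (cmod (z - w))\<^sup>2 / (2 * Im z * Im w))"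

text \<open>
  Closed disks of radius \<open>r\<close> meet iff their centres have distance at most \<open>2 * r\<close>. The placement
  \<open>p\<close> need not be injective: disks may coincide.
\<close>

definition hudg :: "real \<Rightarrow> 'a pair_pre_digraph \<Rightarrow> bool" where
  "hudg r G \<longleftrightarrow> r > 0 \<and> pair_graph G \<and>
     (\<exists>p. (\<forall>v \<in> pverts G. p v \<in> upper_half_plane) \<and>
          (\<forall>u \<in> pverts G. \<forall>v \<in> pverts G. u \<noteq> v \<longrightarrow>
             ((u, v) \<in> parcs G \<longleftrightarrow> hyp_dist (p u) (p v) \<le> 2 * r)))"

definition hudg_family :: "'a pair_pre_digraph set \<Rightarrow> bool" where
  "hudg_family \<G> \<longleftrightarrow> (\<forall>G \<in> \<G>. \<exists>r. hudg r G)"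

definition clique_number :: "'a pair_pre_digraph \<Rightarrow> nat" where
  "clique_number G =
     Max {k. \<exists>S :: 'a pair_pre_digraph. subgraph (with_proj S) (with_proj G) \<and>
                                        complete_digraph k (with_proj S)}"


section \<open>Asymptotics in the number of vertices\<close>

definition clique_number_O :: "(nat \<Rightarrow> real) \<Rightarrow> 'a pair_pre_digraph set \<Rightarrow> bool" where
  "clique_number_O f \<G> \<longleftrightarrow>
     (\<exists>c > 0. \<forall>\<^sub>F n in sequentially. \<forall>G \<in> \<G>. card (pverts G) = n \<longrightarrow>
        real (clique_number G) \<le> c * f n)"

definition disk_radius_O :: "(nat \<Rightarrow> real) \<Rightarrow> 'a pair_pre_digraph set \<Rightarrow> bool" where
  "disk_radius_O f \<G> \<longleftrightarrow>
     (\<exists>c > 0. \<forall>\<^sub>F n in sequentially. \<forall>G \<in> \<G>. card (pverts G) = n \<longrightarrow>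
        (\<exists>r. hudg r G \<and> r \<le> c * f n))"

definition disk_radius_Theta :: "(nat \<Rightarrow> real) \<Rightarrow> 'a pair_pre_digraph set \<Rightarrow> bool" where
  "disk_radius_Theta f \<G> \<longleftrightarrow>
     (\<exists>c\<^sub>1 > 0. \<exists>c\<^sub>2 > 0. \<forall>\<^sub>F n in sequentially. \<forall>G \<in> \<G>. card (pverts G) = n \<longrightarrow>
        (\<exists>r. hudg r G \<and> c\<^sub>1 * f n \<le> r \<and> r \<le> c\<^sub>2 * f n))"


section \<open>Treewidth\<close>

text \<open>
  The predicate \<^const>\<open>tree\<close> of the imported library counts \<open>a, b, a\<close> as a cycle and so rejects
  every symmetric graph with an edge; hence the length bound here. \<^const>\<open>connected\<close> includes
  nonemptiness.
\<close>

definition undirected_tree :: "'a pair_pre_digraph \<Rightarrow> bool" where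
  "undirected_tree T \<longleftrightarrow> pair_graph T \<and> connected (with_proj T) \<and>
     \<not> (\<exists>p. pre_digraph.cycle (with_proj T) p \<and> 3 \<le> length p)"

definition tree_decomposition ::
  "'a pair_pre_digraph \<Rightarrow> 't pair_pre_digraph \<Rightarrow> ('t \<Rightarrow> 'a set) \<Rightarrow> bool" where
  "tree_decomposition G T B \<longleftrightarrow>
     undirected_tree T \<and>
     (\<Union>t \<in> pverts T. B t) = pverts G \<and>
     (\<forall>(u, v) \<in> parcs G. \<exists>t \<in> pverts T. u \<in> B t \<and> v \<in> B t) \<and>
     (\<forall>v \<in> pverts G. connected (with_proj T \<restriction> {t \<in> pverts T. v \<in> B t}))"

definition decomposition_width :: "'t pair_pre_digraph \<Rightarrow> ('t \<Rightarrow> 'a set) \<Rightarrow> nat" where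
  "decomposition_width T B = Max ((\<lambda>t. card (B t)) ` pverts T) - 1"

text \<open>
  Every finite graph is isomorphic to one on natural numbers, so restricting decomposition trees
  (and \<open>H\<close> below) to vertices in \<^typ>\<open>nat\<close> loses nothing. By truncated subtraction the graph
  without vertices gets treewidth \<open>0\<close> instead of \<open>-1\<close>.
\<close>

definition treewidth :: "'a pair_pre_digraph \<Rightarrow> nat" where
  "treewidth G = (LEAST w. \<exists>(T :: nat pair_pre_digraph) B.
     tree_decomposition G T B \<and> decomposition_width T B = w)"


section \<open>Product structure\<close>

definition strong_product ::
  "'a pair_pre_digraph \<Rightarrow> 'b pair_pre_digraph \<Rightarrow> ('a \<times> 'b) pair_pre_digraph" where
  "strong_product G H =
     \<lparr> pverts = pverts G \<times> pverts H,
       parcs = {((u, x), (v, y)) | u x v y.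
         u \<in> pverts G \<and> v \<in> pverts G \<and> x \<in> pverts H \<and> y \<in> pverts H \<and>
         (u, x) \<noteq> (v, y) \<and>
         (u = v \<or> (u, v) \<in> parcs G) \<and> (x = y \<or> (x, y) \<in> parcs H)} \<rparr>"

text \<open>The path with \<open>m\<close> edges; up to isomorphism every (finite) path is of this form.\<close>

definition path_graph :: "nat \<Rightarrow> nat pair_pre_digraph" where
  "path_graph m =
     \<lparr> pverts = {..m},
       parcs = {(i, j). i \<le> m \<and> j \<le> m \<and> (j = Suc i \<or> i = Suc j)} \<rparr>"

definition isomorphic_to_subgraph :: "'a pair_pre_digraph \<Rightarrow> 'b pair_pre_digraph \<Rightarrow> bool" where
  "isomorphic_to_subgraph G K \<longleftrightarrow>
     (\<exists>S :: 'b pair_pre_digraph. subgraph (with_proj S) (with_proj K) \<and>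
                                 digraph_iso (with_proj G) (with_proj S))"

definition row_treewidth :: "'a pair_pre_digraph \<Rightarrow> nat" where
  "row_treewidth G = (LEAST t. \<exists>(H :: nat pair_pre_digraph) m.
     pair_graph H \<and> treewidth H = t \<and>
     isomorphic_to_subgraph G (strong_product H (path_graph m)))"

definition admits_product_structure :: "'a pair_pre_digraph set \<Rightarrow> bool" where
  "admits_product_structure \<G> \<longleftrightarrow> (\<exists>c. \<forall>G \<in> \<G>. row_treewidth G \<le> c)"

end

theory Submission
  imports Defs
begin

text \<open>
  \<^bold>\<open>Bounded radius.\<close> In the half-plane model, a point at height \<open>y\<close> sees, within distance \<open>2 r\<close>,
  only points whose heights differ from \<open>y\<close> by a factor of at most \<open>exp (2 r)\<close> and whose abscissae
  differ by \<open>O(y sinh r)\<close>. So the horizontal strips of height ratio \<open>exp (2 r)\<close> form a layering.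
  Fix an integer \<open>K \<ge> exp (2 r)\<close> and cut the strip \<open>K^i \<le> y < K^(i+1)\<close> into columns of width
  proportional to \<open>K^i sinh r\<close>. In units of the column width, a column begins at a multiple of
  \<open>K^i\<close>, and columns of all levels that begin at the same number are glued to one part. Two
  adjacent points lie in columns that touch, hence in parts that share a bag of the tree of
  \<open>K\<close>-adic intervals, where the bag of \<open>[a K^i, (a+1) K^i]\<close> consists of the multiples of \<open>K^(i-1)\<close>
  in it: bags have at most \<open>K + 1\<close> elements. A part meets a layer in a region that is
  covered by boundedly many cliques, hence in boundedly many vertices. A layering and a partition
  of this kind bound the row treewidth (\<open>row_treewidth_le_layered_partition\<close>). Since the width of
  the columns scales with \<open>sinh r\<close>, nothing degenerates when the radii tend to \<open>0\<close>.

  \<^bold>\<open>Unbounded radius.\<close> An embedding into \<open>H \<boxtimes> P\<close> maps all neighbours of a vertex into three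
  layers, so a large grid-like structure among its neighbours forces a large treewidth of \<open>H\<close>
  (\<open>grid_minor_with_apex_bounds_row_treewidth\<close>). Such a structure exists with bounded clique
  number: put rows of points at heights proportional to \<open>d 0 > d 1 > \<dots>\<close>, with points of row \<open>k\<close> at the
  odd multiples of \<open>d k\<close>. Points of rows \<open>i\<close> and \<open>k\<close> are adjacent roughly when their abscissae
  differ by at most \<open>2 sqrt (d i * d k)\<close>; so rows are paths, and every point of row \<open>0\<close> has a
  neighbour in each row, which gives disjoint stars that cross all rows. One high point, the apex, is
  adjacent to all points of these paths and stars. If the numbers \<open>d k\<close>
  decrease so quickly that \<open>16 * d i * d l < (d j)^2\<close> for \<open>i < j < l\<close>, then a common neighbour in
  row \<open>l\<close> would bring points of the rows \<open>i\<close> and \<open>j\<close> closer than \<open>d j\<close>, which is impossible because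
  their abscissae differ by an odd multiple of \<open>d j\<close>. Hence apart from the apex a clique meets at
  most two rows, each of them in at most two points (\<open>clique_number_nested_rows_graph\<close>). All of
  this works for every sufficiently large radius, independently of its size, so the number of rows can grow
  with any radius function that tends to infinity, and additional points in the last row adjust the
  number of vertices.
\<close>

section \<open>Connected vertex sets and trees\<close>

definition conn :: "'b rel \<Rightarrow> 'b set \<Rightarrow> bool" where
  "conn E S \<longleftrightarrow> S \<noteq> {} \<and> (\<forall>x\<in>S. \<forall>y\<in>S. (x, y) \<in> (Restr E S)\<^sup>*)"

definition simple_cycle :: "'b rel \<Rightarrow> 'b list \<Rightarrow> bool" where
  "simple_cycle E xs \<longleftrightarrow> 3 \<le> length xs \<and> distinct xs \<and>
     (\<forall>i<length xs. (xs ! i, xs ! (Suc i mod length xs)) \<in> E)"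

lemma pair_graph_iff:
  "pair_graph G \<longleftrightarrow> finite (pverts G) \<and> parcs G \<subseteq> pverts G \<times> pverts G \<and> sym (parcs G) \<and> irrefl (parcs G)"
proof
  assume "pair_graph G"
  then interpret pair_graph G .
  show "finite (pverts G) \<and> parcs G \<subseteq> pverts G \<times> pverts G \<and> sym (parcs G) \<and> irrefl (parcs G)"
    using pair_finite_verts arcs_symmetric no_loops' wellformed'
    by (auto simp: sym_def irrefl_def)
next
  assume *: "finite (pverts G) \<and> parcs G \<subseteq> pverts G \<times> pverts G \<and> sym (parcs G) \<and> irrefl (parcs G)"
  then have "finite (parcs G)" by (meson finite_SigmaI finite_subset)
  then show "pair_graph G"
    using * by unfold_locales (auto simp: symmetric_def irrefl_def)
qed

lemma pcas_iff_consecutive: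
  assumes "es \<noteq> []"
  shows "pcas u es v \<longleftrightarrow> fst (hd es) = u \<and> snd (last es) = v \<and>
           (\<forall>i. Suc i < length es \<longrightarrow> snd (es ! i) = fst (es ! Suc i))"
  using assms
proof (induction es arbitrary: u)
  case (Cons e es)
  show ?case
  proof (cases "es = []")
    case False
    have "(\<forall>i. Suc i < length (e # es) \<longrightarrow> snd ((e # es) ! i) = fst ((e # es) ! Suc i)) \<longleftrightarrow>
          snd e = fst (hd es) \<and> (\<forall>i. Suc i < length es \<longrightarrow> snd (es ! i) = fst (es ! Suc i))"
      using False by (auto simp: nth_Cons hd_conv_nth split: nat.splits)
    then show ?thesis using Cons.IH[OF False, of "snd e"] False by auto
  qed auto
qed simp

text \<open>
  Lists of vertices are easier to cut and extend than closed arc walks; a walk of length two back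
  and forth along an edge is excluded by the length bound on both sides.
\<close>
lemma cycle_iff_simple_cycle:
  assumes "pair_graph T"
  shows "(\<exists>p. pre_digraph.cycle (with_proj T) p \<and> 3 \<le> length p) \<longleftrightarrow> (\<exists>xs. simple_cycle (parcs T) xs)"
proof
  interpret pair_graph T by fact
  assume "\<exists>p. cycle p \<and> 3 \<le> length p"
  then obtain p u where p: "awalk u p u" "distinct (tl (pawalk_verts u p))" "p \<noteq> []" "3 \<le> length p"
    unfolding cycle_def by auto
  then have cas: "fst (hd p) = u" "snd (last p) = u"
     "\<And>i. Suc i < length p \<Longrightarrow> snd (p ! i) = fst (p ! Suc i)" and sub: "set p \<subseteq> parcs T"
    using pcas_iff_consecutive[of p u u] by (auto simp: awalk_def)
  have "pawalk_verts u p = map fst p @ [snd (last p)]"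
    using awalk_verts_conv[of u p] p(3) by simp
  then have "distinct (map fst p)"
    using p(2,3) cas by (cases p) auto
  moreover have "(map fst p ! i, map fst p ! (Suc i mod length (map fst p))) \<in> parcs T"
    if "i < length (map fst p)" for i
  proof (cases "Suc i = length p")
    case True
    then have "snd (p ! i) = fst (p ! 0)" using cas(1,2) p(3)
      by (metis diff_Suc_1 hd_conv_nth last_conv_nth)
    then have "(fst (p ! i), fst (p ! 0)) = p ! i" by (metis prod.collapse)
    then show ?thesis using True that sub p(3) nth_mem[of i p] by auto
  next
    case False
    then have "(fst (p ! i), fst (p ! Suc i)) = p ! i" using cas(3)[of i] that by (simp add: prod_eq_iff)
    then show ?thesis using False that sub nth_mem[of i p] by auto
  qed
  ultimately have "simple_cycle (parcs T) (map fst p)"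
    using p(4) unfolding simple_cycle_def by simp
  then show "\<exists>xs. simple_cycle (parcs T) xs" ..
next
  interpret pair_graph T by fact
  assume "\<exists>xs. simple_cycle (parcs T) xs"
  then obtain xs where xs: "3 \<le> length xs" "distinct xs"
     "\<And>i. i < length xs \<Longrightarrow> (xs ! i, xs ! (Suc i mod length xs)) \<in> parcs T"
    unfolding simple_cycle_def by blast
  define n where "n = length xs"
  define p where "p = map (\<lambda>i. (xs ! i, xs ! (Suc i mod n))) [0..<n]"
  have ne: "p \<noteq> []" and len: "length p = n" using xs(1) by (auto simp: p_def n_def)
  have fstp: "map fst p = xs" unfolding p_def n_def by (simp add: o_def map_nth)
  have last: "snd (last p) = xs ! 0"
  proof -
    obtain m where "n = Suc m" using xs(1) by (cases n) (auto simp: n_def)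
    then show ?thesis by (simp add: p_def)
  qed
  have "pcas (xs ! 0) p (xs ! 0)"
    unfolding pcas_iff_consecutive[OF ne]
  proof (intro conjI allI impI)
    show "fst (hd p) = xs ! 0" using ne fstp by (metis hd_conv_nth list.map_sel(1) map_is_Nil_conv)
    show "snd (last p) = xs ! 0" by (rule last)
  next
    fix i assume "Suc i < length p"
    then show "snd (p ! i) = fst (p ! Suc i)" by (simp add: len) (simp add: p_def)
  qed
  moreover have "set p \<subseteq> parcs T" using xs(3) by (auto simp: p_def n_def)
  moreover have "xs ! 0 \<in> pverts T" using xs(1) xs(3)[of 0] wellformed' by fastforce
  ultimately have "awalk (xs ! 0) p (xs ! 0)" by (simp add: awalk_def)
  moreover have "pawalk_verts (xs ! 0) p = xs @ [xs ! 0]"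
    using awalk_verts_conv[of "xs ! 0" p] ne fstp last by simp
  then have "distinct (tl (pawalk_verts (xs ! 0) p))" using xs(1,2) by (cases xs) auto
  ultimately have "cycle p" using ne unfolding cycle_def by auto
  then show "\<exists>p. cycle p \<and> 3 \<le> length p" using len xs(1) n_def by auto
qed

lemma rtrancl_on_eq_rtrancl:
  assumes "x \<in> S" "R \<subseteq> S \<times> S"
  shows "(x, y) \<in> rtrancl_on S R \<longleftrightarrow> (x, y) \<in> R\<^sup>*"
proof
  assume "(x, y) \<in> rtrancl_on S R"
  then show "(x, y) \<in> R\<^sup>*" by (rule rtrancl_on_rtranclI)
next
  assume "(x, y) \<in> R\<^sup>*"
  then show "(x, y) \<in> rtrancl_on S R"
    using assms by (induction) (auto intro: rtrancl_on_into_rtrancl_on)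
qed

lemma connected_induce_iff_conn:
  assumes "pair_graph T"
  shows "connected (with_proj T \<restriction> S) \<longleftrightarrow> conn (parcs T) S"
proof -
  have ends: "arcs_ends (with_proj T \<restriction> S) = Restr (parcs T) S"
    by (auto simp: arcs_ends_def arc_to_ends_def image_iff) 
  have "symcl (Restr (parcs T) S) = Restr (parcs T) S"
    using assms unfolding pair_graph_iff by (auto simp: symcl_def sym_def)
  moreover have "(x, y) \<in> rtrancl_on S (Restr (parcs T) S) \<longleftrightarrow> (x, y) \<in> (Restr (parcs T) S)\<^sup>*" 
    if "x \<in> S" for x y using that by (intro rtrancl_on_eq_rtrancl) auto
  ultimately show ?thesis
    unfolding connected_conv ends conn_def by auto
qed

lemma connected_iff_conn:
  assumes "pair_graph T"
  shows "connected (with_proj T) \<longleftrightarrow> conn (parcs T) (pverts T)"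
proof -
  have "with_proj T \<restriction> pverts T = with_proj T"
    using assms unfolding pair_graph_iff induce_subgraph_def with_proj_def by auto
  then show ?thesis using connected_induce_iff_conn[OF assms, of "pverts T"] by simp
qed

lemma undirected_tree_iff:
  "undirected_tree T \<longleftrightarrow> pair_graph T \<and> conn (parcs T) (pverts T) \<and> (\<nexists>xs. simple_cycle (parcs T) xs)"
  unfolding undirected_tree_def using cycle_iff_simple_cycle connected_iff_conn by blast

lemma tree_decomposition_iff:
  "tree_decomposition G T B \<longleftrightarrow> undirected_tree T \<and> (\<Union>t \<in> pverts T. B t) = pverts G \<and>
     (\<forall>(u, v) \<in> parcs G. \<exists>t \<in> pverts T. u \<in> B t \<and> v \<in> B t) \<and>
     (\<forall>v \<in> pverts G. conn (parcs T) {t \<in> pverts T. v \<in> B t})"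
  unfolding tree_decomposition_def
  using connected_induce_iff_conn undirected_tree_def by blast

definition rooted_tree :: "'b set \<Rightarrow> 'b \<Rightarrow> ('b \<Rightarrow> 'b) \<Rightarrow> 'b pair_pre_digraph" where
  "rooted_tree V rt par =
     \<lparr> pverts = V, parcs = {(v, par v) | v. v \<in> V - {rt}} \<union> {(par v, v) | v. v \<in> V - {rt}} \<rparr>"

lemma conn_symI:
  assumes "sym E" "s \<in> S" "\<And>x. x \<in> S \<Longrightarrow> (x, s) \<in> (Restr E S)\<^sup>*"
  shows "conn E S"
proof -
  have "sym ((Restr E S)\<^sup>*)" using assms(1) by (intro sym_rtrancl) (auto simp: sym_def)
  then show ?thesis unfolding conn_def using assms(2,3) by (meson empty_iff rtrancl_trans symD)
qed

lemma rooted_tree_sym: "sym (parcs (rooted_tree V rt par))"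
  by (auto simp: rooted_tree_def sym_def)

text \<open>
  Walking up from any element of \<open>S\<close> ends in \<open>s\<close>, since \<open>s\<close> is the only element of \<open>S\<close> whose
  parent may lie outside \<open>S\<close>.
\<close>
lemma conn_rooted_tree:
  fixes rank :: "'b \<Rightarrow> nat"
  assumes rank: "\<And>v. v \<in> V \<Longrightarrow> v \<noteq> rt \<Longrightarrow> par v \<in> V \<and> rank (par v) < rank v"
    and S: "S \<subseteq> V" "s \<in> S" "rt \<in> S \<Longrightarrow> s = rt"
    and up: "\<And>t. t \<in> S \<Longrightarrow> t \<noteq> s \<Longrightarrow> par t \<in> S"
  shows "conn (parcs (rooted_tree V rt par)) S"
proof (rule conn_symI[OF rooted_tree_sym S(2)])
  let ?R = "Restr (parcs (rooted_tree V rt par)) S"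
  fix x assume "x \<in> S"
  then show "(x, s) \<in> ?R\<^sup>*"
  proof (induction "rank x" arbitrary: x rule: less_induct)
    case less
    show ?case
    proof (cases "x = s")
      case False
      then have nr: "x \<noteq> rt" and p: "par x \<in> S" using less.prems S(3) up by auto
      then have "(par x, s) \<in> ?R\<^sup>*" using less S(1) rank by blast
      moreover have "(x, par x) \<in> ?R"
        using nr p less.prems S(1) by (auto simp: rooted_tree_def)
      ultimately show ?thesis by (rule converse_rtrancl_into_rtrancl[rotated])
    qed simp
  qed
qed

lemma undirected_tree_rooted_tree:
  fixes rank :: "'b \<Rightarrow> nat"
  assumes "finite V" "rt \<in> V"
    and rank: "\<And>v. v \<in> V \<Longrightarrow> v \<noteq> rt \<Longrightarrow> par v \<in> V \<and> rank (par v) < rank v"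
  shows "undirected_tree (rooted_tree V rt par)"
proof -
  let ?T = "rooted_tree V rt par" 
  have "pair_graph ?T"
    unfolding pair_graph_iff using assms rooted_tree_sym[of V rt par]
    by (fastforce simp: rooted_tree_def irrefl_def)
  moreover have "conn (parcs ?T) (pverts ?T)"
    by (rule conn_rooted_tree[where s = rt, OF rank]) (use assms in \<open>auto simp: rooted_tree_def\<close>)
  moreover have False if "simple_cycle (parcs ?T) xs" for xs
  proof -
    define n where "n = length xs"
    have n: "3 \<le> n" and dist: "distinct xs"
      and arc: "\<And>i. i < n \<Longrightarrow> (xs ! i, xs ! (Suc i mod n)) \<in> parcs ?T"
      using that unfolding simple_cycle_def n_def by auto
    \<comment> \<open>Both neighbours on the cycle of a vertex of maximal rank are its parent.\<close>
    have "\<exists>i. i < n \<and> (\<forall>j. j < n \<longrightarrow> rank (xs ! j) \<le> rank (xs ! i))"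
      using n by (intro ex_has_greatest_nat[of _ 0 _ "Suc (Max ((\<lambda>i. rank (xs ! i)) ` {..<n}))"])
         (auto simp: less_Suc_eq_le)
    then obtain i where i: "i < n" "\<And>j. j < n \<Longrightarrow> rank (xs ! j) \<le> rank (xs ! i)"
      by blast
    have par: "xs ! j = par (xs ! i)"
      if "j < n" "(xs ! i, xs ! j) \<in> parcs ?T \<or> (xs ! j, xs ! i) \<in> parcs ?T" for j
    proof -
      have "xs ! j = par (xs ! i) \<or> (xs ! i = par (xs ! j) \<and> xs ! j \<in> V \<and> xs ! j \<noteq> rt)"
        using that(2) by (auto simp: rooted_tree_def)
      then show ?thesis using rank[of "xs ! j"] i(2)[OF that(1)] by auto
    qed
    define j where "j = Suc i mod n"
    define k where "k = (if i = 0 then n - 1 else i - 1)"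
    have "j < n" "k < n" using n i(1) by (auto simp: j_def k_def)
    moreover have "Suc k mod n = i" using i(1) n by (auto simp: k_def)
    ultimately have "xs ! j = par (xs ! i)" "xs ! k = par (xs ! i)"
      using par[of j] par[of k] arc[of i] arc[of k] i(1) by (auto simp: j_def)
    then have "j = k" using dist \<open>j < n\<close> \<open>k < n\<close> 
      using nth_eq_iff_index_eq[of xs j k] by (simp add: n_def)
    then show False using i(1) n by (auto simp: j_def k_def mod_Suc split: if_splits)
  qed
  ultimately show ?thesis unfolding undirected_tree_iff by blast
qed

text \<open>
  The first vertex of a longest path has all its neighbours on the path, and a neighbour beyond
  the second vertex would close a cycle.
\<close>
lemma forest_has_leaf:
  assumes "finite V" "V \<noteq> {}" "E \<subseteq> V \<times> V" "sym E" "irrefl E" "\<nexists>xs. simple_cycle E xs"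
  shows "\<exists>l\<in>V. \<exists>u. \<forall>w. (l, w) \<in> E \<longrightarrow> w = u"
proof -
  define paths where "paths = {xs. xs \<noteq> [] \<and> distinct xs \<and> set xs \<subseteq> V \<and>
     (\<forall>i. Suc i < length xs \<longrightarrow> (xs ! i, xs ! Suc i) \<in> E)}"
  obtain v where "v \<in> V" using assms(2) by auto
  then have "[v] \<in> paths" by (simp add: paths_def)
  moreover have "\<forall>xs. xs \<in> paths \<longrightarrow> length xs \<le> card V"
    using assms(1) by (simp add: paths_def) (metis card_mono distinct_card)
  ultimately obtain xs where xs: "xs \<in> paths" and max: "\<And>ys. ys \<in> paths \<Longrightarrow> length ys \<le> length xs"
    using ex_has_greatest_nat[of "\<lambda>xs. xs \<in> paths" "[v]" length "Suc (card V)"] by (auto simp: less_Suc_eq_le)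
  have xsD: "xs \<noteq> []" "distinct xs" "set xs \<subseteq> V"
    "\<And>i. Suc i < length xs \<Longrightarrow> (xs ! i, xs ! Suc i) \<in> E"
    using xs by (auto simp: paths_def)
  have "w = xs ! 1" if w: "(xs ! 0, w) \<in> E" for w
  proof -
    have "w \<in> set xs"
    proof (rule ccontr)
      assume "w \<notin> set xs"
      moreover have "(w, xs ! 0) \<in> E" using w assms(4) by (meson symD)
      ultimately have "w # xs \<in> paths"
        using xsD assms(3) by (auto simp: paths_def nth_Cons split: nat.splits)
      then show False using max[of "w # xs"] by simp
    qed
    then obtain i where i: "i < length xs" "w = xs ! i" by (auto simp: in_set_conv_nth)
    have "i \<noteq> 0" using w i assms(5) by (metis irrefl_def)
    moreover have "\<not> 2 \<le> i"
    proof
      assume "2 \<le> i"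
      have "simple_cycle E (take (Suc i) xs)"
        unfolding simple_cycle_def
      proof (intro conjI allI impI)
        fix j assume "j < length (take (Suc i) xs)"
        then have j: "j \<le> i" using i by simp
        show "(take (Suc i) xs ! j, take (Suc i) xs ! (Suc j mod length (take (Suc i) xs))) \<in> E"
        proof (cases "j = i")
          case True
          then have "take (Suc i) xs ! j = w" "Suc j mod length (take (Suc i) xs) = 0"
            "take (Suc i) xs ! 0 = xs ! 0"
            using i by (simp_all add: min_absorb2 Suc_leI)
          then show ?thesis using w assms(4) by (metis symD)
        next
          case False
          then show ?thesis using i j xsD(4)[of j] by (simp add: min_def)
        qed
      qed (use \<open>2 \<le> i\<close> i xsD in auto)
      then show False using assms(6) by blast
    qed
    ultimately have "i = 1" by linarith
    then show ?thesis using i by simp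
  qed
  then show ?thesis using xsD by (intro bexI[of _ "xs ! 0"] exI[of _ "xs ! 1"]) auto
qed

lemma conn_remove_leaf:
  assumes "sym E" "\<And>w. (l, w) \<in> E \<Longrightarrow> w = u" "conn E S" "S \<noteq> {l}" "S \<subseteq> V"
  shows "conn (Restr E (V - {l})) (S - {l})"
proof -
  let ?R = "Restr (Restr E (V - {l})) (S - {l})"
  have nbr: "w = u" if "(l, w) \<in> E \<or> (w, l) \<in> E" for w
    using that assms(1,2) by (meson symD)
  have *: "(x, if z = l then u else z) \<in> ?R\<^sup>*" if "(x, z) \<in> (Restr E S)\<^sup>*" "x \<noteq> l" "x \<in> S" for x z
    using that
  proof (induction)
    case (step y z)
    consider "y = l" "z = l" | "y = l" "z \<noteq> l" | "y \<noteq> l" "z = l" | "y \<noteq> l" "z \<noteq> l" by blast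
    then show ?case
    proof cases
      case 4
      then have "(y, z) \<in> ?R" using step(2) assms(5) by auto
      then show ?thesis using 4 step.IH step.prems by (simp add: rtrancl.rtrancl_into_rtrancl)
    qed (use step nbr in auto)
  qed simp
  show ?thesis
    unfolding conn_def
  proof (intro conjI ballI)
    show "S - {l} \<noteq> {}" using assms(3,4) by (auto simp: conn_def)
    fix x y assume "x \<in> S - {l}" "y \<in> S - {l}"
    then show "(x, y) \<in> ?R\<^sup>*"
      using *[of x y] assms(3) by (auto simp: conn_def)
  qed
qed

text \<open>
  Subtrees of a tree have the Helly property. Induction removes a leaf \<open>l\<close>: unless \<open>{l}\<close> is a
  member of the family, every member through \<open>l\<close> contains the neighbour of \<open>l\<close> as well, so
  the members still meet pairwise without \<open>l\<close>.
\<close>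
lemma forest_helly:
  assumes "finite V" "E \<subseteq> V \<times> V" "sym E" "irrefl E" "\<nexists>xs. simple_cycle E xs"
    and "\<And>S. S \<in> \<F> \<Longrightarrow> S \<subseteq> V \<and> conn E S"
    and "\<And>S S'. S \<in> \<F> \<Longrightarrow> S' \<in> \<F> \<Longrightarrow> S \<inter> S' \<noteq> {}"
  shows "\<exists>t. \<forall>S\<in>\<F>. t \<in> S"
  using assms
proof (induction "card V" arbitrary: V E \<F>)
  case 0
  then have "V = {}" by simp
  then show ?case using 0 by (fastforce simp: conn_def)
next
  case (Suc n)
  note prems = Suc.prems
  have "V \<noteq> {}" using Suc.hyps(2) by auto
  then obtain l u where lu: "l \<in> V" "\<And>w. (l, w) \<in> E \<Longrightarrow> w = u"
    using forest_has_leaf[OF prems(1) _ prems(2-5)] by auto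
  show ?case
  proof (cases "{l} \<in> \<F>")
    case True
    then show ?thesis using prems(7)[of "{l}"] by (intro exI[of _ l]) auto
  next
    case False
    define E' where "E' = Restr E (V - {l})"
    have u: "u \<in> S - {l}" if "S \<in> \<F>" "l \<in> S" for S
    proof -
      have c: "conn E S" and "S \<noteq> {l}" using prems(6) that False by auto
      have "\<exists>y. y \<in> S \<and> y \<noteq> l" using that \<open>S \<noteq> {l}\<close> by blast
      then obtain y where "y \<in> S" "y \<noteq> l" by blast
      then have "(l, y) \<in> (Restr E S)\<^sup>*" using c that by (auto simp: conn_def)
      then obtain w where "(l, w) \<in> Restr E S" using \<open>y \<noteq> l\<close> by (auto elim: converse_rtranclE)
      then show ?thesis using lu(2)[of w] prems(4) by (auto simp: irrefl_def)
    qed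
    have "\<exists>t. \<forall>S\<in>(\<lambda>S. S - {l}) ` \<F>. t \<in> S"
    proof (rule Suc.hyps(1))
      show "n = card (V - {l})" "finite (V - {l})" using Suc.hyps(2) prems(1) lu(1) by auto
      show "E' \<subseteq> (V - {l}) \<times> (V - {l})" "sym E'" "irrefl E'"
        using prems(3,4) by (auto simp: E'_def sym_def irrefl_def)
      show "\<nexists>xs. simple_cycle E' xs"
        using prems(5) by (auto simp: E'_def simple_cycle_def)
    next
      fix S assume "S \<in> (\<lambda>S. S - {l}) ` \<F>"
      then obtain S0 where S0: "S0 \<in> \<F>" "S = S0 - {l}" by auto
      moreover have "conn E' (S0 - {l})"
        unfolding E'_def using conn_remove_leaf[OF prems(3) lu(2)] prems(6)[OF S0(1)] False S0(1) by blast
      ultimately show "S \<subseteq> V - {l} \<and> conn E' S" using prems(6) by auto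
    next
      fix S S' assume "S \<in> (\<lambda>S. S - {l}) ` \<F>" "S' \<in> (\<lambda>S. S - {l}) ` \<F>"
      then obtain S0 S0' where S0: "S0 \<in> \<F>" "S = S0 - {l}" "S0' \<in> \<F>" "S' = S0' - {l}" by auto
      then obtain z where "z \<in> S0 \<inter> S0'" using prems(7) by fastforce
      then show "S \<inter> S' \<noteq> {}" using S0 u by (cases "z = l") auto
    qed
    then show ?thesis by auto
  qed
qed

lemma undirected_treeD:
  assumes "undirected_tree T"
  shows "finite (pverts T)" "pverts T \<noteq> {}" "parcs T \<subseteq> pverts T \<times> pverts T" "sym (parcs T)"
    "irrefl (parcs T)" "\<nexists>xs. simple_cycle (parcs T) xs"
  using assms by (auto simp: undirected_tree_iff pair_graph_iff conn_def)

section \<open>Tree decompositions and row treewidth\<close>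
lemma conn_Un:
  assumes "sym E" "conn E S" "conn E S'" "S \<inter> S' \<noteq> {}"
  shows "conn E (S \<union> S')"
proof -
  obtain s where s: "s \<in> S" "s \<in> S'" using assms(4) by auto
  have "(Restr E S)\<^sup>* \<subseteq> (Restr E (S \<union> S'))\<^sup>*" "(Restr E S')\<^sup>* \<subseteq> (Restr E (S \<union> S'))\<^sup>*"
    by (rule rtrancl_mono; auto)+
  then show ?thesis
    using s assms(2,3) unfolding conn_def[of E S] conn_def[of E S']
    by (intro conn_symI[OF assms(1), of s]) blast+
qed

text \<open>
  The nodes whose bags meet a connected set form a subtree: consecutive vertices of a
  walk share a bag. The map \<open>\<pi>\<close> allows this for graphs that are merely mapped to
  the decomposed graph, with edges possibly contracted.
\<close>
lemma conn_trace:
  assumes td: "tree_decomposition H T B" and X: "conn E X" "\<pi> ` X \<subseteq> pverts H"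
    and hom: "\<And>x y. x \<in> X \<Longrightarrow> y \<in> X \<Longrightarrow> (x, y) \<in> E \<Longrightarrow> \<pi> x = \<pi> y \<or> (\<pi> x, \<pi> y) \<in> parcs H"
  shows "conn (parcs T) {t \<in> pverts T. \<exists>x\<in>X. \<pi> x \<in> B t}" (is "conn _ ?S")
proof -
  let ?N = "\<lambda>v. {t \<in> pverts T. v \<in> B t}"
  have conn: "conn (parcs T) (?N (\<pi> x))" if "x \<in> X" for x
    using td X(2) that by (auto simp: tree_decomposition_iff)
  have sym: "sym (parcs T)" using td by (simp add: tree_decomposition_iff undirected_treeD(4))
  have mono: "(s, t) \<in> (Restr (parcs T) ?S)\<^sup>*" if "s \<in> ?N (\<pi> x)" "t \<in> ?N (\<pi> x)" "x \<in> X" for s t x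
  proof -
    have "(s, t) \<in> (Restr (parcs T) (?N (\<pi> x)))\<^sup>*" using conn[OF that(3)] that(1,2) by (simp add: conn_def)
    moreover have "(Restr (parcs T) (?N (\<pi> x)))\<^sup>* \<subseteq> (Restr (parcs T) ?S)\<^sup>*"
      using that(3) by (intro rtrancl_mono) auto
    ultimately show ?thesis by auto
  qed
  obtain x0 s0 where x0: "x0 \<in> X" "s0 \<in> ?N (\<pi> x0)"
    using X(1) conn by (fastforce simp: conn_def)
  have *: "\<forall>t\<in>?N (\<pi> x). (s0, t) \<in> (Restr (parcs T) ?S)\<^sup>*" if "(x0, x) \<in> (Restr E X)\<^sup>*" for x
    using that
  proof (induction)
    case base
    then show ?case using mono x0 by blast
  next
    case (step x y)
    then have xy: "x \<in> X" "y \<in> X" "\<pi> x = \<pi> y \<or> (\<pi> x, \<pi> y) \<in> parcs H" using hom by auto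
    have "\<exists>t. t \<in> ?N (\<pi> x) \<and> t \<in> ?N (\<pi> y)"
    proof (cases "\<pi> x = \<pi> y")
      case True
      then show ?thesis using conn[OF xy(1)] by (auto simp: conn_def)
    next
      case False
      then show ?thesis using xy(3) td by (fastforce simp: tree_decomposition_iff)
    qed
    then obtain t where t: "t \<in> ?N (\<pi> x)" "t \<in> ?N (\<pi> y)" by blast
    show ?case
    proof
      fix t' assume "t' \<in> ?N (\<pi> y)"
      then have "(t, t') \<in> (Restr (parcs T) ?S)\<^sup>*" using mono t(2) xy(2) by blast
      then show "(s0, t') \<in> (Restr (parcs T) ?S)\<^sup>*" using step.IH t(1) by (meson rtrancl_trans)
    qed
  qed
  show ?thesis
  proof (rule conn_symI[OF sym, of s0])
    show "s0 \<in> ?S" using x0 by auto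
    fix t assume "t \<in> ?S"
    then obtain x where x: "x \<in> X" "t \<in> ?N (\<pi> x)" by blast
    then have "(x0, x) \<in> (Restr E X)\<^sup>*" using X(1) x0(1) by (simp add: conn_def)
    then have "(s0, t) \<in> (Restr (parcs T) ?S)\<^sup>*" using * x(2) by blast
    moreover have "sym ((Restr (parcs T) ?S)\<^sup>*)"
      using sym by (intro sym_rtrancl) (auto simp: sym_def)
    ultimately show "(t, s0) \<in> (Restr (parcs T) ?S)\<^sup>*" by (meson symD)
  qed
qed

text \<open>
  Pairwise intersecting connected sets form a bramble; by the Helly property their traces in the tree
  have a common node.
\<close>
lemma tree_decomposition_bag_meets_all:
  assumes td: "tree_decomposition H T B"
    and conn: "\<And>X. X \<in> \<B> \<Longrightarrow> conn E X \<and> \<pi> ` X \<subseteq> pverts H"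
    and hom: "\<And>x y. (x, y) \<in> E \<Longrightarrow> \<pi> x = \<pi> y \<or> (\<pi> x, \<pi> y) \<in> parcs H"
    and meet: "\<And>X Y. X \<in> \<B> \<Longrightarrow> Y \<in> \<B> \<Longrightarrow> X \<inter> Y \<noteq> {}"
  shows "\<exists>t\<in>pverts T. \<forall>X\<in>\<B>. \<exists>x\<in>X. \<pi> x \<in> B t"
proof -
  have T: "undirected_tree T" using td by (simp add: tree_decomposition_iff)
  let ?S = "\<lambda>X. {t \<in> pverts T. \<exists>x\<in>X. \<pi> x \<in> B t}"
  have ex: "\<exists>t. \<forall>S\<in>?S ` \<B>. t \<in> S"
  proof (rule forest_helly[OF undirected_treeD(1,3-6)[OF T]])
    fix S assume "S \<in> ?S ` \<B>"
    then obtain X where X: "X \<in> \<B>" "S = ?S X" by blast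
    have "conn (parcs T) (?S X)"
      by (rule conn_trace[OF td, of E]) (use conn[OF X(1)] hom in blast)+
    then show "S \<subseteq> pverts T \<and> conn (parcs T) S" using X(2) by blast
  next
    fix S S' assume "S \<in> ?S ` \<B>" "S' \<in> ?S ` \<B>"
    then obtain X Y where XY: "X \<in> \<B>" "Y \<in> \<B>" "S = ?S X" "S' = ?S Y" by blast
    then obtain x where x: "x \<in> X" "x \<in> Y" using meet by blast
    then have "\<pi> x \<in> pverts H" using conn XY by blast
    moreover have "(\<Union>t\<in>pverts T. B t) = pverts H" using td by (simp add: tree_decomposition_iff)
    ultimately obtain t where "t \<in> pverts T" "\<pi> x \<in> B t" by blast
    then show "S \<inter> S' \<noteq> {}" using x XY by blast
  qed
  show ?thesis
  proof (cases "\<B> = {}")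
    case True
    then show ?thesis using undirected_treeD(2)[OF T] by auto
  next
    case False
    then show ?thesis using ex by auto
  qed
qed

lemma isomorphic_to_subgraphI:
  assumes G: "pair_graph G" and K: "pair_wf_digraph K"
    and inj: "inj_on f (pverts G)" and verts: "f ` pverts G \<subseteq> pverts K"
    and arcs: "\<And>u v. (u, v) \<in> parcs G \<Longrightarrow> (f u, f v) \<in> parcs K"
  shows "isomorphic_to_subgraph G K"
proof -
  interpret pair_graph G by fact
  define S where "S = \<lparr> pverts = f ` pverts G, parcs = map_prod f f ` parcs G \<rparr>"
  define hom where "hom = \<lparr> iso_verts = f, iso_arcs = map_prod f f, iso_head = snd, iso_tail = fst \<rparr>"
  have S: "pair_wf_digraph S"
    using wellformed' by unfold_locales (fastforce simp: S_def)+
  have "inj_on (map_prod f f) (parcs G)"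
    using inj wellformed' by (auto simp: inj_on_def)
  then have "digraph_isomorphism hom"
    using inj by (auto simp: digraph_isomorphism_def hom_def wf_digraph_axioms)
  moreover have "with_proj S = app_iso hom (with_proj G)"
    by (simp add: S_def hom_def app_iso_def with_proj_def)
  ultimately have "digraph_iso (with_proj G) (with_proj S)"
    unfolding digraph_iso_def by auto
  moreover have "subgraph (with_proj S) (with_proj K)"
    using S K verts arcs unfolding subgraph_def wf_digraph_wp_iff
    by (auto simp: S_def)
  ultimately show ?thesis unfolding isomorphic_to_subgraph_def by blast
qed

lemma isomorphic_to_subgraphD:
  assumes "isomorphic_to_subgraph G K" 
  shows "\<exists>f. inj_on f (pverts G) \<and> f ` pverts G \<subseteq> pverts K \<and> 
    (\<forall>u v. (u, v) \<in> parcs G \<longrightarrow> (f u, f v) \<in> parcs K)"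
proof -
  obtain S h where S: "subgraph (with_proj S) (with_proj K)"
    and h: "pre_digraph.digraph_isomorphism (with_proj G) h" "with_proj S = app_iso h (with_proj G)"
    using assms unfolding isomorphic_to_subgraph_def digraph_iso_def by blast
  have tl: "iso_tail h = fst" and hd: "iso_head h = snd" and V: "pverts S = iso_verts h ` pverts G"
    and A: "parcs S = iso_arcs h ` parcs G"
    using h(2) by (auto simp: app_iso_def with_proj_def)
  have "inj_on (iso_verts h) (pverts G)"
    using h(1) by (simp add: pre_digraph.digraph_isomorphism_def)
  moreover have "(iso_verts h u, iso_verts h v) = iso_arcs h (u, v)" if "(u, v) \<in> parcs G" for u v
    using h(1) that tl hd by (fastforce simp: pre_digraph.digraph_isomorphism_def prod_eq_iff)
  ultimately show ?thesis
    using S V A unfolding subgraph_def by (intro exI[of _ "iso_verts h"]) auto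
qed

lemma strong_product_wf: "pair_wf_digraph (strong_product H P)"
  by unfold_locales (auto simp: strong_product_def)

lemma single_bag_tree_decomposition:
  "tree_decomposition H (rooted_tree {t} t id) (\<lambda>_. pverts H)" if "pair_graph H"
proof -
  have "undirected_tree (rooted_tree {t} t id)"
    by (rule undirected_tree_rooted_tree) auto
  then show ?thesis
    using that by (auto simp: tree_decomposition_iff pair_graph_iff rooted_tree_def conn_def)
qed

lemma treewidth_witness:
  assumes "pair_graph H"
  shows "\<exists>(T :: nat pair_pre_digraph) B. tree_decomposition H T B \<and>
    (\<forall>t\<in>pverts T. card (B t) \<le> Suc (treewidth H))"
proof -
  have "\<exists>w (T :: nat pair_pre_digraph) B. tree_decomposition H T B \<and> decomposition_width T B = w"
    using single_bag_tree_decomposition[OF assms, of "0 :: nat"] by blast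
  from LeastI_ex[OF this] obtain T :: "nat pair_pre_digraph" and B
    where TB: "tree_decomposition H T B" "decomposition_width T B = treewidth H"
    unfolding treewidth_def by blast
  have "finite (pverts T)" using TB(1) by (simp add: tree_decomposition_iff undirected_treeD(1))
  then have "card (B t) \<le> Suc (treewidth H)" if "t \<in> pverts T" for t
  proof -
    have "card (B t) \<le> Max ((\<lambda>t. card (B t)) ` pverts T)"
      using \<open>finite (pverts T)\<close> that by (intro Max_ge) auto
    then show ?thesis using TB(2) unfolding decomposition_width_def by linarith
  qed
  with TB(1) show ?thesis by blast
qed

lemma treewidth_le:
  fixes T :: "nat pair_pre_digraph"
  assumes td: "tree_decomposition H T B" and "\<And>t. t \<in> pverts T \<Longrightarrow> card (B t) \<le> Suc w"
  shows "treewidth H \<le> w"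
proof -
  have "finite (pverts T)" "pverts T \<noteq> {}"
    using td by (auto simp: tree_decomposition_iff dest: undirected_treeD)
  then have "Max ((\<lambda>t. card (B t)) ` pverts T) \<le> Suc w" using assms(2) by simp
  then have "decomposition_width T B \<le> w" unfolding decomposition_width_def by linarith
  moreover have "treewidth H \<le> decomposition_width T B"
    unfolding treewidth_def by (rule Least_le) (use td in blast)
  ultimately show ?thesis by simp
qed

lemma row_treewidth_le:
  fixes H :: "nat pair_pre_digraph"
  assumes "pair_graph H" "isomorphic_to_subgraph G (strong_product H (path_graph m))"
  shows "row_treewidth G \<le> treewidth H"
  unfolding row_treewidth_def by (rule Least_le) (use assms in blast)

lemma row_treewidth_le_card:
  assumes G: "pair_graph G"
  shows "\<exists>H :: nat pair_pre_digraph. pair_graph H \<and>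
    isomorphic_to_subgraph G (strong_product H (path_graph 0)) \<and> treewidth H \<le> card (pverts G)"
proof -
  have fin: "finite (pverts G)" using G by (simp add: pair_graph_iff)
  then obtain f :: "'a \<Rightarrow> nat" where f: "inj_on f (pverts G)"
    using finite_imp_inj_to_nat_seg[OF fin] by (elim exE conjE)
  define H where "H = \<lparr> pverts = f ` pverts G, parcs = map_prod f f ` parcs G \<rparr>"
  have H: "pair_graph H"
    unfolding pair_graph_iff
  proof (intro conjI)
    have "sym (parcs G)" "irrefl (parcs G)" "parcs G \<subseteq> pverts G \<times> pverts G"
      using G by (auto simp: pair_graph_iff)
    then show "sym (parcs H)" "irrefl (parcs H)" "parcs H \<subseteq> pverts H \<times> pverts H"
      using f by (auto simp: H_def sym_def irrefl_def dest: inj_onD)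
  qed (use fin in \<open>simp add: H_def\<close>)
  have "isomorphic_to_subgraph G (strong_product H (path_graph 0))"
  proof (rule isomorphic_to_subgraphI[OF G strong_product_wf, where f = "\<lambda>v. (f v, 0)"])
    show "inj_on (\<lambda>v. (f v, 0)) (pverts G)" using f by (auto simp: inj_on_def)
    show "(\<lambda>v. (f v, 0)) ` pverts G \<subseteq> pverts (strong_product H (path_graph 0))"
      by (auto simp: strong_product_def path_graph_def H_def)
    fix u v assume uv: "(u, v) \<in> parcs G"
    then have "u \<in> pverts G" "v \<in> pverts G" "u \<noteq> v" using G by (auto simp: pair_graph_iff irrefl_def)
    moreover from this have "f u \<noteq> f v" using f by (auto dest: inj_onD)
    moreover have "(f u, f v) \<in> parcs H" using uv by (auto simp: H_def)
    ultimately show "((f u, 0), (f v, 0)) \<in> parcs (strong_product H (path_graph 0))"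
      by (auto simp: strong_product_def path_graph_def) (auto simp: H_def)
  qed
  moreover have "treewidth H \<le> card (pverts G)"
    using fin by (intro treewidth_le[OF single_bag_tree_decomposition[OF H, of 0]])
      (simp add: H_def card_image_le le_SucI)
  ultimately show ?thesis using H by blast
qed

lemma row_treewidth_witness:
  assumes G: "pair_graph G"
  obtains H :: "nat pair_pre_digraph" and m where "pair_graph H" "treewidth H = row_treewidth G"
    "isomorphic_to_subgraph G (strong_product H (path_graph m))"
proof -
  have "\<exists>t (H :: nat pair_pre_digraph) m. pair_graph H \<and> treewidth H = t \<and>
     isomorphic_to_subgraph G (strong_product H (path_graph m))"
    using row_treewidth_le_card[OF G] by blast
  from LeastI_ex[OF this] show ?thesis
    unfolding row_treewidth_def[symmetric] using that by blast
qed

text \<open>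
  The crosses \<open>P i \<union> Q j\<close> form a bramble, so the vertices mapped to some bag of \<open>H\<close> hit all of them. Fewer
  than \<open>M\<close> vertices miss some \<open>P i\<close> and some \<open>Q j\<close> by disjointness, so at least \<open>M\<close> vertices are
  mapped to this bag, and the apex \<open>a\<close> confines them to three copies of it.
\<close>
lemma grid_minor_with_apex_bounds_row_treewidth:
  assumes G: "pair_graph G" and a: "\<And>i v. i < M \<Longrightarrow> v \<in> P i \<union> Q i \<Longrightarrow> v \<noteq> a \<Longrightarrow> (a, v) \<in> parcs G"
    and P: "\<And>i. i < M \<Longrightarrow> conn (parcs G) (P i) \<and> P i \<subseteq> pverts G" "disjoint_family_on P {..<M}"
    and Q: "\<And>i. i < M \<Longrightarrow> conn (parcs G) (Q i) \<and> Q i \<subseteq> pverts G" "disjoint_family_on Q {..<M}"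
    and PQ: "\<And>i j. i < M \<Longrightarrow> j < M \<Longrightarrow> P i \<inter> Q j \<noteq> {}"
  shows "M \<le> 3 * Suc (row_treewidth G)"
proof (cases "M = 0")
  case False
  obtain H :: "nat pair_pre_digraph" and m where H: "pair_graph H" "treewidth H = row_treewidth G"
    and iso: "isomorphic_to_subgraph G (strong_product H (path_graph m))"
    by (rule row_treewidth_witness[OF G])
  obtain T :: "nat pair_pre_digraph" and B where td: "tree_decomposition H T B"
    and width: "\<And>t. t \<in> pverts T \<Longrightarrow> card (B t) \<le> Suc (row_treewidth G)"
    using treewidth_witness[OF H(1), unfolded H(2)] by blast
  obtain f where f: "inj_on f (pverts G)" "f ` pverts G \<subseteq> pverts (strong_product H (path_graph m))"
    "\<And>u v. (u, v) \<in> parcs G \<Longrightarrow> (f u, f v) \<in> parcs (strong_product H (path_graph m))"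
    using isomorphic_to_subgraphD[OF iso] by blast
  have sym: "sym (parcs G)" and finG: "finite (pverts G)" using G by (auto simp: pair_graph_iff)
  define \<B> where "\<B> = {P i \<union> Q j | i j. i < M \<and> j < M}"
  have "\<exists>t\<in>pverts T. \<forall>X\<in>\<B>. \<exists>x\<in>X. (fst \<circ> f) x \<in> B t"
  proof (rule tree_decomposition_bag_meets_all[OF td, where E = "parcs G"])
    fix X assume "X \<in> \<B>"
    then obtain i j where ij: "i < M" "j < M" "X = P i \<union> Q j" by (auto simp: \<B>_def)
    then have "conn (parcs G) X" "X \<subseteq> pverts G" using conn_Un[OF sym] P(1) Q(1) PQ by auto
    moreover have "fst (f x) \<in> pverts H" if "x \<in> pverts G" for x
      using f(2) that by (auto simp: strong_product_def)
    ultimately show "conn (parcs G) X \<and> (fst \<circ> f) ` X \<subseteq> pverts H" by auto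
  next
    fix x y assume "(x, y) \<in> parcs G"
    then show "(fst \<circ> f) x = (fst \<circ> f) y \<or> ((fst \<circ> f) x, (fst \<circ> f) y) \<in> parcs H"
      using f(3)[of x y] by (auto simp: strong_product_def)
  next
    fix X Y assume "X \<in> \<B>" "Y \<in> \<B>"
    then show "X \<inter> Y \<noteq> {}" using PQ unfolding \<B>_def by blast
  qed
  then obtain t where t: "t \<in> pverts T" and "\<forall>X\<in>\<B>. \<exists>x\<in>X. (fst \<circ> f) x \<in> B t" by blast
  then have hit: "\<exists>x\<in>P i \<union> Q j. fst (f x) \<in> B t" if "i < M" "j < M" for i j
    using that unfolding \<B>_def comp_def by blast
  define Z where "Z = (\<Union>i<M. P i \<union> Q i)"
  have Z: "Z \<subseteq> pverts G" using P(1) Q(1) by (auto simp: Z_def)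
  define W where "W = {x \<in> Z. fst (f x) \<in> B t}"
  \<comment> \<open>All vertices of the crosses lie in the layer of the apex or in one of the two layers next to it.\<close>
  define l where "l = snd (f a)"
  have "f ` W \<subseteq> B t \<times> {l - 1..l + 1}"
  proof
    fix y assume "y \<in> f ` W"
    then obtain x where x: "x \<in> Z" "fst (f x) \<in> B t" "y = f x" by (auto simp: W_def)
    have "snd (f x) \<in> {l - 1..l + 1}"
    proof (cases "x = a")
      case False
      then have "(a, x) \<in> parcs G" using a x(1) by (auto simp: Z_def)
      from f(3)[OF this] show ?thesis by (auto simp: strong_product_def path_graph_def l_def)
    qed (auto simp: l_def)
    then show "y \<in> B t \<times> {l - 1..l + 1}" using x by (auto simp: mem_Times_iff)
  qed
  moreover have "finite (B t)"
    using td t H(1) by (auto simp: tree_decomposition_iff pair_graph_iff intro: finite_subset)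
  ultimately have "card (f ` W) \<le> card (B t \<times> {l - 1..l + 1})" by (intro card_mono) auto
  also have "\<dots> \<le> 3 * Suc (row_treewidth G)"
  proof -
    have "card {l - 1..l + 1} \<le> 3" by simp
    then show ?thesis using mult_le_mono[OF width[OF t]] 
      unfolding card_cartesian_product by (subst (2) mult.commute)
  qed
  finally have "card (f ` W) \<le> 3 * Suc (row_treewidth G)" .
  moreover have "W \<subseteq> pverts G" using Z by (auto simp: W_def)
  ultimately have W: "card W \<le> 3 * Suc (row_treewidth G)"
    using card_image[OF inj_on_subset[OF f(1)], of W] by simp
  have miss: "\<exists>i<M. R i \<inter> W = {}" if "card W < M" "disjoint_family_on R {..<M}" for R :: "nat \<Rightarrow> 'a set"
  proof (rule ccontr)
    assume "\<not> ?thesis"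
    then have "\<forall>i\<in>{..<M}. \<exists>x. x \<in> R i \<inter> W" by blast
    from bchoice[OF this] obtain g where g: "\<forall>i\<in>{..<M}. g i \<in> R i \<inter> W" by blast
    have "inj_on g {..<M}"
    proof (rule inj_onI, rule ccontr)
      fix i j assume ij: "i \<in> {..<M}" "j \<in> {..<M}" "g i = g j" "i \<noteq> j"
      have "g i \<in> R i" "g j \<in> R j" using g ij(1,2) by blast+
      moreover have "R i \<inter> R j = {}" using disjoint_family_onD[OF that(2) ij(1,2,4)] .
      ultimately show False using ij(3) by (metis disjoint_iff)
    qed
    moreover have "g ` {..<M} \<subseteq> W" "finite W" using g finG finite_subset[OF Z] by (auto simp: W_def)
    ultimately have "M \<le> card W" using card_inj_on_le[of g "{..<M}" W] by simp
    then show False using that(1) by simp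
  qed
  show ?thesis
  proof (rule ccontr)
    assume "\<not> ?thesis"
    then have "card W < M" using W by simp
    then obtain i j where ij: "i < M" "j < M" "P i \<inter> W = {}" "Q j \<inter> W = {}"
      using miss[OF _ P(2)] miss[OF _ Q(2)] by blast
    then obtain x where "x \<in> P i \<union> Q j" "fst (f x) \<in> B t" using hit by blast
    moreover have "P i \<union> Q j \<subseteq> Z" using ij by (auto simp: Z_def)
    ultimately show False using ij by (auto simp: W_def)
  qed
qed simp

text \<open>
  The layers become the vertices of the path, and \<open>H\<close> arises from the tree \<open>T\<close> of bags of parts by
  replacing each part with \<open>c\<close> copies, enough to tell apart the vertices that share part and layer,
  and joining all vertices that share a bag. Copy \<open>i\<close> of part \<open>x\<close> is the number \<open>x * c + i\<close>.
\<close>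
lemma row_treewidth_le_layered_partition:
  fixes T :: "nat pair_pre_digraph" and L part :: "'a \<Rightarrow> nat"
  assumes G: "pair_graph G" and T: "undirected_tree T"
    and bags: "\<And>t. t \<in> pverts T \<Longrightarrow> finite (B t) \<and> card (B t) \<le> w"
    and conn: "\<And>x. x \<in> (\<Union>t\<in>pverts T. B t) \<Longrightarrow> conn (parcs T) {t \<in> pverts T. x \<in> B t}"
    and cover: "part ` pverts G \<subseteq> (\<Union>t\<in>pverts T. B t)"
    and edges: "\<And>u v. (u, v) \<in> parcs G \<Longrightarrow> L u \<le> Suc (L v) \<and>
                   (\<exists>t\<in>pverts T. part u \<in> B t \<and> part v \<in> B t)"
    and fibre: "\<And>x l. card {v \<in> pverts G. part v = x \<and> L v = l} \<le> c"
  shows "row_treewidth G \<le> w * c"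
proof (cases "pverts G = {}")
  case True
  then show ?thesis using row_treewidth_le_card[OF G] row_treewidth_le by (metis card.empty le_trans le_zero_eq zero_le)
next
  case False
  have finG: "finite (pverts G)" and symG: "sym (parcs G)" and subG: "parcs G \<subseteq> pverts G \<times> pverts G"
    and irrG: "irrefl (parcs G)" using G by (auto simp: pair_graph_iff)
  define F where "F v = {u \<in> pverts G. part u = part v \<and> L u = L v}" for v
  have F: "finite (F v)" "card (F v) \<le> c" for v using finG fibre by (auto simp: F_def)
  have "c > 0"
  proof -
    obtain v where "v \<in> pverts G" using False by blast
    then have "F v \<noteq> {}" by (auto simp: F_def)
    then show ?thesis using F[of v] by (metis card_gt_0_iff gr0I le_zero_eq)
  qed
  \<comment> \<open>Number the vertices within each intersection of a part and a layer.\<close>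
  define num where "num A = (SOME h. bij_betw h A {0..<card A})" for A :: "'a set"
  have num: "bij_betw (num A) A {0..<card A}" if "finite A" for A
    unfolding num_def by (rule someI_ex[OF ex_bij_betw_finite_nat[OF that]])
  define g where "g v = part v * c + num (F v) v" for v
  have num_less: "num (F v) v < c" if "v \<in> pverts G" for v
  proof -
    have "v \<in> F v" using that by (simp add: F_def)
    then have "num (F v) v \<in> {0..<card (F v)}" using bij_betwE[OF num[OF F(1)]] by blast
    then show ?thesis using F(2)[of v] by simp
  qed
  have g_div: "g v div c = part v" and g_mod: "g v mod c = num (F v) v" if "v \<in> pverts G" for v
    using num_less[OF that] \<open>c > 0\<close> by (simp_all add: g_def)
  define bag where "bag t = {h. h div c \<in> B t}" for t
  have bag_eq: "bag t = (\<lambda>(x, i). x * c + i) ` (B t \<times> {..<c})" for t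
  proof -
    have "bag t \<subseteq> (\<lambda>(x, i). x * c + i) ` (B t \<times> {..<c})"
    proof
      fix h assume "h \<in> bag t"
      then show "h \<in> (\<lambda>(x, i). x * c + i) ` (B t \<times> {..<c})"
        using \<open>c > 0\<close> by (intro image_eqI[of _ _ "(h div c, h mod c)"]) (auto simp: bag_def)
    qed
    then show ?thesis using \<open>c > 0\<close> by (auto simp: bag_def)
  qed
  define H where "H = \<lparr> pverts = (\<Union>t\<in>pverts T. bag t),
      parcs = {(h, h'). h \<noteq> h' \<and> (\<exists>t\<in>pverts T. h \<in> bag t \<and> h' \<in> bag t)} \<rparr>"
  have fin_bag: "finite (bag t)" and card_bag: "card (bag t) \<le> w * c" if "t \<in> pverts T" for t
  proof -
    have fB: "finite (B t)" "card (B t) \<le> w" using bags[OF that] by auto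
    then show "finite (bag t)" by (simp add: bag_eq)
    have "card (bag t) \<le> card (B t \<times> {..<c})"
      unfolding bag_eq using fB by (intro card_image_le) auto
    also have "\<dots> \<le> w * c" using fB by (simp add: card_cartesian_product)
    finally show "card (bag t) \<le> w * c" .
  qed
  have H: "pair_graph H"
    using fin_bag undirected_treeD(1)[OF T]
    by (auto simp: pair_graph_iff H_def sym_def irrefl_def)
  have td: "tree_decomposition H T bag"
    unfolding tree_decomposition_iff
  proof (intro conjI ballI)
    fix h assume "h \<in> pverts H"
    then have "h div c \<in> (\<Union>t\<in>pverts T. B t)" by (auto simp: H_def bag_def)
    from conn[OF this] show "conn (parcs T) {t \<in> pverts T. h \<in> bag t}" by (simp add: bag_def)
  qed (use T in \<open>auto simp: H_def\<close>)
  define m where "m = Max (L ` pverts G)"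
  have L_le: "L v \<le> m" if "v \<in> pverts G" for v using finG that by (simp add: m_def)
  have gH: "g v \<in> pverts H" if "v \<in> pverts G" for v
    using cover that g_div[OF that] by (auto simp: H_def bag_def)
  have inj: "inj_on (\<lambda>v. (g v, L v)) (pverts G)"
  proof (rule inj_onI)
    fix u v assume uv: "u \<in> pverts G" "v \<in> pverts G" "(g u, L u) = (g v, L v)"
    then have "part u = part v" "num (F u) u = num (F v) v" "L u = L v"
      using g_div g_mod by (metis prod.inject)+
    moreover from this have "F u = F v" by (simp add: F_def)
    moreover have "u \<in> F u" "v \<in> F v" using uv by (auto simp: F_def)
    ultimately show "u = v" using num[OF F(1)] by (metis bij_betw_imp_inj_on inj_onD)
  qed
  have "isomorphic_to_subgraph G (strong_product H (path_graph m))"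
  proof (rule isomorphic_to_subgraphI[OF G strong_product_wf inj])
    show "(\<lambda>v. (g v, L v)) ` pverts G \<subseteq> pverts (strong_product H (path_graph m))"
      using gH L_le by (auto simp: strong_product_def path_graph_def)
    fix u v assume uv: "(u, v) \<in> parcs G"
    then have V: "u \<in> pverts G" "v \<in> pverts G" "u \<noteq> v" using subG irrG by (auto simp: irrefl_def)
    then have ne: "(g u, L u) \<noteq> (g v, L v)" using inj by (auto dest: inj_onD)
    have "(v, u) \<in> parcs G" using uv symG by (meson symD)
    then have "L u \<le> Suc (L v)" "L v \<le> Suc (L u)" using edges uv by blast+
    then have "L u = L v \<or> (L u, L v) \<in> parcs (path_graph m)"
      using L_le V by (auto simp: path_graph_def)
    moreover have "g u = g v \<or> (g u, g v) \<in> parcs H"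
      using edges[OF uv] V g_div by (auto simp: H_def bag_def)
    ultimately show "((g u, L u), (g v, L v)) \<in> parcs (strong_product H (path_graph m))"
      using ne V gH L_le by (auto simp: strong_product_def) (auto simp: path_graph_def)
  qed
  then have "row_treewidth G \<le> treewidth H" by (rule row_treewidth_le[OF H])
  also have "\<dots> \<le> w * c" using treewidth_le[OF td] card_bag by (meson le_SucI)
  finally show ?thesis .
qed

section \<open>The tree of adic intervals\<close>

text \<open>
  The node \<open>(i, a)\<close> stands for the interval \<open>[a K^i, (a+1) K^i]\<close> within \<open>[0, K^N]\<close>, and its parent for
  the interval of the next level that contains it.
\<close>
definition adic_nodes :: "nat \<Rightarrow> nat \<Rightarrow> nat set" where
  "adic_nodes K N = {prod_encode (i, a) | i a. i \<le> N \<and> a < K ^ (N - i)}"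

definition adic_parent :: "nat \<Rightarrow> nat \<Rightarrow> nat" where
  "adic_parent K t = (case prod_decode t of (i, a) \<Rightarrow> prod_encode (Suc i, a div K))"

definition adic_tree :: "nat \<Rightarrow> nat \<Rightarrow> nat pair_pre_digraph" where
  "adic_tree K N = rooted_tree (adic_nodes K N) (prod_encode (N, 0)) (adic_parent K)"

text \<open>
  The endpoints of the subintervals of the next lower level, its own endpoints included. On level \<open>0\<close> the truncated
  \<open>i - 1\<close> is \<open>0\<close>, and the bag consists of the two endpoints.
\<close>
definition adic_bag :: "nat \<Rightarrow> nat \<Rightarrow> nat set" where
  "adic_bag K t = (case prod_decode t of (i, a) \<Rightarrow> {x. K ^ (i - 1) dvd x \<and> a * K ^ i \<le> x \<and> x \<le> Suc a * K ^ i})"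

lemma adic_nodes_encode [simp]: "prod_encode (i, a) \<in> adic_nodes K N \<longleftrightarrow> i \<le> N \<and> a < K ^ (N - i)"
  by (auto simp: adic_nodes_def dest: injD[OF inj_prod_encode])

lemma adic_bag_encode [simp]:
  "x \<in> adic_bag K (prod_encode (i, a)) \<longleftrightarrow> K ^ (i - 1) dvd x \<and> a * K ^ i \<le> x \<and> x \<le> Suc a * K ^ i"
  by (simp add: adic_bag_def)

lemma pverts_adic_tree [simp]: "pverts (adic_tree K N) = adic_nodes K N"
  by (simp add: adic_tree_def rooted_tree_def)

lemma finite_adic_nodes: "finite (adic_nodes K N)"
proof -
  have "adic_nodes K N = prod_encode ` (SIGMA i:{..N}. {..<K ^ (N - i)})"
    by (force simp: adic_nodes_def)
  then show ?thesis by simp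
qed

lemma adic_parent_descends:
  assumes "K \<ge> 2" "t \<in> adic_nodes K N" "t \<noteq> prod_encode (N, 0)"
  shows "adic_parent K t \<in> adic_nodes K N \<and>
    N - fst (prod_decode (adic_parent K t)) < N - fst (prod_decode t)"
proof -
  obtain i a where t: "t = prod_encode (i, a)" "i \<le> N" "a < K ^ (N - i)"
    using assms(2) by (auto simp: adic_nodes_def)
  have "i \<noteq> N" using t assms(3) by auto
  then have "K ^ (N - i) = K * K ^ (N - Suc i)" using t(2) by (metis Suc_diff_Suc le_neq_implies_less power_Suc)
  then have "a div K < K ^ (N - Suc i)"
    using t(3) assms(1) by (simp add: less_mult_imp_div_less mult.commute)
  then show ?thesis using t \<open>i \<noteq> N\<close> by (auto simp: adic_parent_def)
qed

lemma undirected_tree_adic_tree: "K \<ge> 2 \<Longrightarrow> undirected_tree (adic_tree K N)"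
  unfolding adic_tree_def
  by (rule undirected_tree_rooted_tree[OF finite_adic_nodes, where rank = "\<lambda>t. N - fst (prod_decode t)"])
     (use adic_parent_descends in auto)

text \<open>
  If the bag of an interval contains \<open>x\<close> and \<open>x\<close> is a multiple of the length of the interval, then the bag of
  its parent contains \<open>x\<close>, too. Otherwise \<open>x\<close> lies in the interior of the interval; this
  happens on at most one level and for only one interval. This interval, or the root if there is
  none, is the top of all nodes whose bag contains \<open>x\<close>.
\<close>
lemma conn_adic_bags:
  assumes K: "K \<ge> 2" and x: "x \<in> (\<Union>t\<in>adic_nodes K N. adic_bag K t)"
  shows "conn (parcs (adic_tree K N)) {t \<in> adic_nodes K N. x \<in> adic_bag K t}" (is "conn _ ?S")
proof -
  define lev where "lev t = fst (prod_decode t)" for t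
  have "\<exists>s. s \<in> ?S" using x by auto
  then obtain s0 where "s0 \<in> ?S" ..
  moreover have "\<forall>t. t \<in> ?S \<longrightarrow> lev t < Suc N" by (auto simp: lev_def adic_nodes_def)
  ultimately have "\<exists>s. s \<in> ?S \<and> (\<forall>t. t \<in> ?S \<longrightarrow> lev t \<le> lev s)"
    by (rule ex_has_greatest_nat)
  then obtain s where s: "s \<in> ?S" "\<And>t. t \<in> ?S \<Longrightarrow> lev t \<le> lev s" by blast
  obtain m b where mb: "s = prod_encode (m, b)" "m \<le> N" "b < K ^ (N - m)"
    using s(1) by (auto simp: adic_nodes_def)
  have xs: "K ^ (m - 1) dvd x" "b * K ^ m \<le> x" "x \<le> Suc b * K ^ m" using s(1) mb by auto
  have up: "adic_parent K t \<in> ?S" if t: "t = prod_encode (i, a)" "t \<in> ?S" "i < N" "K ^ i dvd x" for t i a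
  proof -
    have b: "a * K ^ i \<le> x" "x \<le> Suc a * K ^ i" "a < K ^ (N - i)" using t by auto
    have "a div K * K \<le> a" "Suc a \<le> Suc (a div K) * K"
      using K by (auto simp: Suc_le_eq dividend_less_div_times) 
    then have "a div K * K * K ^ i \<le> a * K ^ i" "Suc a * K ^ i \<le> Suc (a div K) * K * K ^ i"
      using mult_le_mono1 by blast+
    then have "a div K * (K * K ^ i) \<le> x" "x \<le> Suc (a div K) * (K * K ^ i)"
      using b unfolding mult.assoc by linarith+
    then have "x \<in> adic_bag K (adic_parent K t)"
      using t(1,4) by (simp add: adic_parent_def del: mult_Suc)
    then show ?thesis using adic_parent_descends[OF K, of t N] t by (auto simp: mb)
  qed
  show ?thesis
    unfolding adic_tree_def
  proof (rule conn_rooted_tree[where rank = "\<lambda>t. N - fst (prod_decode t)" and s = s,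
        OF adic_parent_descends[OF K]])
    show "?S \<subseteq> adic_nodes K N" by auto
    show "s \<in> ?S" by (rule s(1))
    assume "prod_encode (N, 0) \<in> ?S"
    from s(2)[OF this] show "s = prod_encode (N, 0)" using mb by (simp add: lev_def)
  next
    fix t assume t: "t \<in> ?S" "t \<noteq> s"
    then obtain i a where ia: "t = prod_encode (i, a)" "i \<le> N" "a < K ^ (N - i)"
      by (auto simp: adic_nodes_def)
    have "i \<le> m" using s(2)[OF t(1)] ia mb by (simp add: lev_def)
    show "adic_parent K t \<in> ?S"
    proof (cases "i = m")
      case False
      then have "i \<le> m - 1" using \<open>i \<le> m\<close> by linarith
      with xs(1) have "K ^ i dvd x" by (rule power_le_dvd)
      then show ?thesis using up[OF ia(1) t(1)] False \<open>i \<le> m\<close> mb(2) by simp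
    next
      case True
      have bds: "a * K ^ m \<le> x" "x \<le> Suc a * K ^ m" using t(1) ia True by auto
      have "m \<noteq> N" using True ia mb t(2) by auto
      \<comment> \<open>On the top level \<open>m\<close> the number \<open>x\<close> lies in the interior of its interval.\<close>
      have "\<not> K ^ m dvd x"
      proof
        assume "K ^ m dvd x"
        then have "adic_parent K s \<in> ?S" using up[OF mb(1) s(1)] \<open>m \<noteq> N\<close> mb(2) by simp
        from s(2)[OF this] show False by (simp add: lev_def mb(1) adic_parent_def)
      qed
      then have ne: "k * K ^ m \<noteq> x" for k by auto
      have "a * K ^ m < x" "b * K ^ m < x"
        using bds(1) xs(2) ne by (simp_all add: order.strict_iff_order)
      then have "a * K ^ m < Suc b * K ^ m" "b * K ^ m < Suc a * K ^ m"
        using bds(2) xs(3) by linarith+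
      then have "a < Suc b" "b < Suc a" using mult_less_cancel2 by blast+
      then have "a = b" by simp
      then show ?thesis using t(2) ia mb True by simp
    qed
  qed
qed

lemma adic_bag_card:
  assumes "K \<ge> 2"
  shows "finite (adic_bag K t) \<and> card (adic_bag K t) \<le> Suc K"
proof -
  obtain i a where t: "prod_decode t = (i, a)" by fastforce
  define d where "d = K ^ (i - 1)"
  have d: "d > 0" using assms by (simp add: d_def)
  have Kd: "K ^ i \<le> K * d" using assms by (cases i) (auto simp: d_def)
  have "adic_bag K t \<subseteq> (\<lambda>j. (a * K ^ i div d + j) * d) ` {..K}"
  proof
    fix x assume "x \<in> adic_bag K t"
    then have x: "d dvd x" "a * K ^ i \<le> x" "x \<le> Suc a * K ^ i" by (auto simp: adic_bag_def t d_def)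
    then obtain k where k: "x = k * d" by (metis dvd_div_mult_self)
    have dvd: "d dvd a * K ^ i" by (simp add: d_def le_imp_power_dvd dvd_mult)
    then obtain a' where a': "a * K ^ i = a' * d" by (metis dvd_div_mult_self)
    have "a' \<le> k" using x(2) k a' d by simp
    moreover have "k * d \<le> (K + a') * d" using x(3) k a' Kd by (simp add: add_mult_distrib)
    then have "k \<le> K + a'" using d by simp
    ultimately show "x \<in> (\<lambda>j. (a * K ^ i div d + j) * d) ` {..K}"
      using k a' d by (intro image_eqI[of _ _ "k - a'"]) auto
  qed
  moreover have "card ((\<lambda>j. (a * K ^ i div d + j) * d) ` {..K}) \<le> Suc K"
    using card_image_le[of "{..K}"] by fastforce
  ultimately show ?thesis by (meson card_mono finite_atMost finite_imageI finite_subset le_trans)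
qed

section \<open>Disk graphs of bounded radius\<close>

text \<open>
  By \<open>cosh (2 r) = 1 + 2 (sinh r)^2\<close> the condition is polynomial in the coordinates.
\<close>
lemma hyp_dist_le_iff:
  assumes "Im z > 0" "Im w > 0" "r \<ge> 0"
  shows "hyp_dist z w \<le> 2 * r \<longleftrightarrow>
    (Re z - Re w)\<^sup>2 + (Im z - Im w)\<^sup>2 \<le> 4 * (sinh r)\<^sup>2 * (Im z * Im w)"
proof -
  define t where "t = 1 + (cmod (z - w))\<^sup>2 / (2 * Im z * Im w)"
  have pos: "Im z * Im w > 0" using assms(1,2) by (rule mult_pos_pos)
  then have t: "t \<ge> 1" unfolding t_def mult.assoc by simp
  have "hyp_dist z w \<le> 2 * r \<longleftrightarrow> cosh (arcosh t) \<le> cosh (2 * r)"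
    unfolding hyp_dist_def t_def[symmetric]
    using cosh_real_nonneg_le_iff[of "arcosh t" "2 * r"] assms(3) arcosh_nonneg_real[OF t] by argo
  also have "\<dots> \<longleftrightarrow> t \<le> 1 + 2 * (sinh r)\<^sup>2"
    unfolding cosh_arcosh_real[OF t] cosh_double cosh_square_eq by (simp add: add.commute)
  also have "\<dots> \<longleftrightarrow> (cmod (z - w))\<^sup>2 \<le> 4 * (sinh r)\<^sup>2 * (Im z * Im w)"
  proof -
    have "t \<le> 1 + 2 * (sinh r)\<^sup>2 \<longleftrightarrow> (cmod (z - w))\<^sup>2 / (2 * (Im z * Im w)) \<le> 2 * (sinh r)\<^sup>2"
      by (simp add: t_def mult.assoc)
    also have "\<dots> \<longleftrightarrow> (cmod (z - w))\<^sup>2 \<le> 2 * (sinh r)\<^sup>2 * (2 * (Im z * Im w))"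
      using pos by (intro pos_divide_le_eq) simp
    finally show ?thesis by (simp add: mult.assoc)
  qed
  finally show ?thesis by (simp add: cmod_power2)
qed

text \<open>
  This is \<open>hyp_dist_le_iff\<close> for two points on a vertical line, whose distance is \<open>\<bar>ln (y / y')\<bar>\<close>. With
  \<open>E = exp (2 \<rho>)\<close> the difference of the two sides factors as \<open>(E y' - y) (E y - y') / E\<close>.
\<close>
lemma sq_diff_le_sinh_iff:
  fixes y y' \<rho> :: real
  assumes "y > 0" "y' > 0" "\<rho> \<ge> 0"
  shows "(y - y')\<^sup>2 \<le> 4 * (sinh \<rho>)\<^sup>2 * (y * y') \<longleftrightarrow> y \<le> exp (2 * \<rho>) * y' \<and> y' \<le> exp (2 * \<rho>) * y"
proof -
  define E where "E = exp (2 * \<rho>)"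
  have E: "E \<ge> 1" "E > 0" using assms(3) by (auto simp: E_def)
  have "4 * (sinh \<rho>)\<^sup>2 = (exp \<rho> - exp (- \<rho>))\<^sup>2"
    by (simp add: sinh_field_def power_divide)
  also have "\<dots> = E + inverse E - 2"
  proof -
    have "exp \<rho> * exp \<rho> = E" "exp (- \<rho>) * exp (- \<rho>) = inverse E" "exp \<rho> * exp (- \<rho>) = 1"
      by (simp_all add: E_def exp_minus[symmetric] flip: exp_add)
    then show ?thesis
      unfolding power2_diff unfolding power2_eq_square by (simp add: mult.assoc)
  qed
  finally have S: "4 * (sinh \<rho>)\<^sup>2 = E + inverse E - 2" .
  have "4 * (sinh \<rho>)\<^sup>2 * (y * y') - (y - y')\<^sup>2 = inverse E * ((E * y' - y) * (E * y - y'))"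
    unfolding S using E by (simp add: field_simps power2_eq_square)
  moreover have "inverse E * ((E * y' - y) * (E * y - y')) \<ge> 0 \<longleftrightarrow> (E * y' - y) * (E * y - y') \<ge> 0"
    using E by (simp add: zero_le_mult_iff)
  moreover have "(E * y' - y) * (E * y - y') \<ge> 0 \<longleftrightarrow> y \<le> E * y' \<and> y' \<le> E * y"
  proof -
    have "y \<le> E * y" "y' \<le> E * y'" using E assms by auto
    then have "\<not> (E * y' - y < 0 \<and> E * y - y' < 0)" by linarith
    then show ?thesis unfolding zero_le_mult_iff using \<open>y \<le> E * y\<close> \<open>y' \<le> E * y'\<close> assms(1,2) by argo
  qed
  ultimately show ?thesis unfolding E_def by linarith
qed

lemma card_le_card_fibres:
  assumes "finite I" "f ` A \<subseteq> I" "\<And>i. i \<in> I \<Longrightarrow> card {a \<in> A. f a = i} \<le> k"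
  shows "card A \<le> card I * k"
proof -
  have "A = (\<Union>i\<in>I. {a \<in> A. f a = i})" using assms(2) by auto
  then have "card A \<le> (\<Sum>i\<in>I. card {a \<in> A. f a = i})" using card_UN_le[OF assms(1)] by metis
  also have "\<dots> \<le> card I * k" using sum_bounded_above[of I _ k] assms(3) by fastforce
  finally show ?thesis .
qed

lemma card_clique_le_clique_number:
  assumes G: "pair_graph G" and C: "C \<subseteq> pverts G" "\<And>u v. u \<in> C \<Longrightarrow> v \<in> C \<Longrightarrow> u \<noteq> v \<Longrightarrow> (u, v) \<in> parcs G"
  shows "card C \<le> clique_number G"
proof -
  let ?A = "{k. \<exists>S. subgraph (with_proj S) (with_proj G) \<and> complete_digraph k (with_proj S)}"
  have fin: "finite (pverts G)" using G by (simp add: pair_graph_iff)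
  define S where "S = \<lparr> pverts = C, parcs = {(u, v). u \<in> C \<and> v \<in> C \<and> u \<noteq> v} \<rparr>"
  have "complete_digraph (card C) (with_proj S)"
    unfolding complete_digraph_pair_def using C(1) fin by (auto simp: S_def intro: finite_subset)
  moreover have "subgraph (with_proj S) (with_proj G)"
    using C G unfolding subgraph_def wf_digraph_wp_iff
    by (auto simp: S_def pair_wf_digraph_def pair_graph_iff)
  ultimately have "card C \<in> ?A" by blast
  moreover have "?A \<subseteq> {..card (pverts G)}"
    using fin by (auto simp: subgraph_def complete_digraph_pair_def intro: card_mono)
  then have "finite ?A" by (rule finite_subset) simp
  ultimately show ?thesis unfolding clique_number_def by (intro Max_ge) auto
qed

definition adic_level :: "nat \<Rightarrow> real \<Rightarrow> nat" where
  "adic_level K y = nat \<lfloor>log K y\<rfloor>"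

lemma adic_level_bounds:
  assumes "K \<ge> 2" "y \<ge> 1"
  shows "real K ^ adic_level K y \<le> y" "y < real K ^ Suc (adic_level K y)"
proof -
  let ?i = "adic_level K y"
  have nn: "log K y \<ge> 0" using assms by simp
  then have "real ?i \<le> log K y" "log K y < real (Suc ?i)"
    unfolding adic_level_def by linarith+
  then have "real K powr real ?i \<le> y" "y < real K powr real (Suc ?i)"
    using assms by (simp_all add: le_log_iff log_less_iff)
  then show "real K ^ ?i \<le> y" "y < real K ^ Suc ?i"
    using assms by (simp_all add: powr_realpow del: power_Suc of_nat_Suc)
qed

lemma adic_level_le:
  assumes "K \<ge> 2" "y \<ge> 1" "y' \<ge> 1" "y \<le> real K * y'"
  shows "adic_level K y \<le> Suc (adic_level K y')"
proof -
  have "real K ^ adic_level K y \<le> y" using adic_level_bounds(1) assms by simp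
  also have "\<dots> \<le> real K * y'" by (rule assms)
  also have "\<dots> < real K * real K ^ Suc (adic_level K y')" using adic_level_bounds(2)[of K y'] assms by simp
  finally have "real K ^ adic_level K y < real K ^ Suc (Suc (adic_level K y'))" by simp
  then have "adic_level K y < Suc (Suc (adic_level K y'))"
    using assms(1) by (subst (asm) power_strict_increasing_iff) auto
  then show ?thesis by simp
qed

text \<open>
  Here \<open>s\<close> and \<open>t\<close> lie in half-open intervals of equal or consecutive levels, at a distance of at
  most the shorter length \<open>K^i\<close>. Measured in units of \<open>K^i\<close>, the second interval begins at \<open>q\<close> and ends
  at \<open>q'\<close>, and the hypotheses force \<open>q \<le> a + 1\<close> and \<open>a \<le> q'\<close>. So either \<open>a\<close> is one of the subdivision
  points of the second interval, or the second interval begins where the first one ends.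
\<close>
lemma adic_bag_of_near_columns:
  fixes s t :: real
  assumes K: "K \<ge> 2" and ij: "i \<le> j" "j \<le> Suc i"
    and a: "real a * real K ^ i \<le> s" "s < real (Suc a) * real K ^ i"
    and c: "real c * real K ^ j \<le> t" "t < real (Suc c) * real K ^ j"
    and st: "\<bar>s - t\<bar> \<le> real K ^ i"
    and N: "a * K ^ i < K ^ N" "c * K ^ j < K ^ N" "j \<le> N"
  shows "\<exists>n\<in>adic_nodes K N. a * K ^ i \<in> adic_bag K n \<and> c * K ^ j \<in> adic_bag K n"
proof -
  have Ki: "real K ^ i > 0" using K by simp
  have node: "prod_encode (l, b) \<in> adic_nodes K N" if "b * K ^ l < K ^ N" "l \<le> N" for l b
  proof -
    have "K ^ N = K ^ (N - l) * K ^ l" using that(2) by (simp flip: power_add)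
    then have "b < K ^ (N - l)" using that(1) by (metis mult_less_cancel2)
    then show ?thesis using that by simp
  qed
  have dvd: "K ^ (l - 1) dvd b * K ^ l" for l b by (simp add: le_imp_power_dvd dvd_mult)
  define q where "q = c * K ^ (j - i)"
  have q: "c * K ^ j = q * K ^ i" using ij(1) by (simp add: q_def mult.assoc flip: power_add)
  then have qr: "real c * real K ^ j = real q * real K ^ i" by (metis of_nat_mult of_nat_power)
  define q' where "q' = Suc c * K ^ (j - i)"
  have q': "Suc c * K ^ j = q' * K ^ i" using ij(1) unfolding q'_def by (simp only: mult.assoc flip: power_add) simp
  then have qr': "real (Suc c) * real K ^ j = real q' * real K ^ i" by (metis of_nat_mult of_nat_power)
  have "real q * real K ^ i < (real a + 2) * real K ^ i"
    using a(2) c(1) st qr by (simp add: algebra_simps)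
  then have "q < a + 2" using Ki by (simp add: mult_less_cancel_right)
  have "real a * real K ^ i < (real q' + 1) * real K ^ i"
    using a(1) c(2) st qr' by (simp add: algebra_simps)
  then have "real a < real q' + 1" using Ki by (simp add: mult_less_cancel_right)
  then have "a \<le> q'" by linarith
  show ?thesis
  proof (cases "q \<le> a")
    case True
    have "c * K ^ j \<le> a * K ^ i" "a * K ^ i \<le> Suc c * K ^ j"
      unfolding q q' using True \<open>a \<le> q'\<close> by simp_all
    moreover have "K ^ (j - 1) dvd a * K ^ i" using ij by (simp add: le_imp_power_dvd dvd_mult)
    ultimately show ?thesis
      using node[OF N(2,3)] dvd by (intro bexI[of _ "prod_encode (j, c)"]) auto
  next
    case False
    then have "q = Suc a" using \<open>q < a + 2\<close> by simp
    then show ?thesis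
      using node[OF N(1)] N(3) ij dvd[of i a] dvd[of i q]
      by (intro bexI[of _ "prod_encode (i, a)"]) (auto simp: q)
  qed
qed

text \<open>
  The number \<open>s v\<close> is the abscissa in units of the column width \<open>w\<close>. The factor \<open>K^2\<close> in \<open>w\<close>
  makes adjacent points with lower level \<open>i\<close> differ by at most \<open>w * K^i\<close>: their heights are below
  \<open>K^(i+2)\<close>, so their abscissae differ by at most \<open>2 sinh r * K^(i+2)\<close>.
\<close>
lemma row_treewidth_half_plane_le:
  fixes x y :: "'a \<Rightarrow> real"
  assumes G: "pair_graph G" and ne: "pverts G \<noteq> {}" and r: "r > 0" and K: "exp (2 * r) \<le> real K"
    and xy: "\<And>v. v \<in> pverts G \<Longrightarrow> x v \<ge> 0 \<and> y v \<ge> 1"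
    and adj: "\<And>u v. u \<in> pverts G \<Longrightarrow> v \<in> pverts G \<Longrightarrow> u \<noteq> v \<Longrightarrow> (u, v) \<in> parcs G \<longleftrightarrow>
       (x u - x v)\<^sup>2 + (y u - y v)\<^sup>2 \<le> 4 * (sinh r)\<^sup>2 * (y u * y v)"
    and clique: "clique_number G \<le> k"
  shows "row_treewidth G \<le> Suc K * (16 * K ^ 3 * k)"
proof -
  have finG: "finite (pverts G)" and symG: "sym (parcs G)" and subG: "parcs G \<subseteq> pverts G \<times> pverts G"
    and irrG: "irrefl (parcs G)" using G by (auto simp: pair_graph_iff)
  have "exp (2 * r) > 1" using r by simp
  then have K2: "K \<ge> 2" using K by linarith
  define \<sigma> where "\<sigma> = 2 * sinh r"
  have \<sigma>: "\<sigma> > 0" using r by (simp add: \<sigma>_def)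
  define w where "w = \<sigma> * K\<^sup>2"
  have w: "w > 0" using \<sigma> K2 by (simp add: w_def)
  define lv where "lv v = adic_level K (y v)" for v
  define s where "s v = x v / w" for v
  define col where "col v = nat \<lfloor>s v / real K ^ lv v\<rfloor>" for v
  define X where "X v = col v * K ^ lv v" for v
  define L where "L v = nat \<lfloor>ln (y v) / (2 * r)\<rfloor>" for v
  have Kpos: "real K ^ i > 0" for i using K2 by simp
  have lv: "real K ^ lv v \<le> y v" "y v < real K ^ Suc (lv v)" if "v \<in> pverts G" for v
    unfolding lv_def using adic_level_bounds[OF K2] xy[OF that] by auto
  have s_nonneg: "s v \<ge> 0" if "v \<in> pverts G" for v using xy[OF that] w by (simp add: s_def)
  have col: "real (col v) * real K ^ lv v \<le> s v" "s v < real (Suc (col v)) * real K ^ lv v"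
    if "v \<in> pverts G" for v
  proof -
    have "s v / real K ^ lv v \<ge> 0" using s_nonneg[OF that] by simp
    then have "real (col v) \<le> s v / real K ^ lv v" "s v / real K ^ lv v < real (Suc (col v))"
      unfolding col_def by linarith+
    then show "real (col v) * real K ^ lv v \<le> s v" "s v < real (Suc (col v)) * real K ^ lv v"
      using Kpos by (simp_all only: pos_le_divide_eq pos_divide_less_eq)
  qed
  have near: "y u \<le> exp (2 * r) * y v" "\<bar>s u - s v\<bar> \<le> real K ^ lv v"
    if uv: "(u, v) \<in> parcs G" for u v
  proof -
    have V: "u \<in> pverts G" "v \<in> pverts G" "u \<noteq> v" using uv subG irrG by (auto simp: irrefl_def)
    have pos: "y u > 0" "y v > 0" using xy V by (meson less_le_trans zero_less_one)+
    have d: "(x u - x v)\<^sup>2 + (y u - y v)\<^sup>2 \<le> 4 * (sinh r)\<^sup>2 * (y u * y v)"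
      using adj[OF V] uv by simp
    then have "(y u - y v)\<^sup>2 \<le> 4 * (sinh r)\<^sup>2 * (y u * y v)"
      using order_trans[OF _ d, of "(y u - y v)\<^sup>2"] by simp
    then show 1: "y u \<le> exp (2 * r) * y v" using sq_diff_le_sinh_iff[OF pos] r by simp
    define i where "i = lv v"
    have "y v \<le> real K ^ (i + 1)" using lv(2)[OF V(2)] by (simp add: i_def)
    moreover have "y u \<le> real K ^ (i + 2)"
    proof -
      have "y u \<le> real K * y v" using 1 K pos(2) by (meson less_imp_le mult_right_mono order_trans)
      also have "\<dots> \<le> real K * real K ^ (i + 1)" using \<open>y v \<le> _\<close> by (intro mult_left_mono) auto
      finally show ?thesis by simp
    qed
    ultimately have "y u * y v \<le> real K ^ (i + 2) * real K ^ (i + 1)"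
      using pos by (intro mult_mono) auto
    also have "\<dots> \<le> real K ^ (i + 2) * real K ^ (i + 2)"
      using K2 by (intro mult_left_mono power_increasing) auto
    finally have "\<sigma>\<^sup>2 * (y u * y v) \<le> \<sigma>\<^sup>2 * (real K ^ (i + 2) * real K ^ (i + 2))"
      by (intro mult_left_mono) auto
    also have "\<dots> = (w * real K ^ i)\<^sup>2" by (simp add: w_def power2_eq_square power_add algebra_simps)
    finally have "\<sigma>\<^sup>2 * (y u * y v) \<le> (w * real K ^ i)\<^sup>2" .
    moreover have "(x u - x v)\<^sup>2 \<le> \<sigma>\<^sup>2 * (y u * y v)"
      using order_trans[OF _ d, of "(x u - x v)\<^sup>2"] by (simp add: \<sigma>_def power_mult_distrib)
    ultimately have "\<bar>x u - x v\<bar>\<^sup>2 \<le> (w * real K ^ i)\<^sup>2" unfolding power2_abs by (rule order_trans[rotated])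
    then have "\<bar>x u - x v\<bar> \<le> w * real K ^ i"
      by (rule power2_le_imp_le) (use w Kpos[of i] in simp)
    then have "\<bar>x u - x v\<bar> / w \<le> real K ^ i" using w by (simp add: pos_divide_le_eq mult.commute)
    then show "\<bar>s u - s v\<bar> \<le> real K ^ lv v"
      using w by (simp add: s_def i_def flip: diff_divide_distrib)
  qed
  \<comment> \<open>Large enough for all parts and levels to fit below the root interval \<open>[0, K^N]\<close>, as \<open>N < K^N\<close>.\<close>
  define N where "N = Max ((\<lambda>v. X v + lv v) ` pverts G)"
  have N: "X v + lv v \<le> N" if "v \<in> pverts G" for v unfolding N_def using finG that by (intro Max_ge) auto
  have XN: "X v < K ^ N" if "v \<in> pverts G" for v
    using N[OF that] power_gt_expt[of K N] K2 by linarith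
  have common_bag: "\<exists>n\<in>adic_nodes K N. X u \<in> adic_bag K n \<and> X v \<in> adic_bag K n"
    if uv: "(u, v) \<in> parcs G" "lv u \<le> lv v" for u v
  proof -
    have V: "u \<in> pverts G" "v \<in> pverts G" using uv subG by auto
    have vu: "(v, u) \<in> parcs G" using uv symG by (meson symD)
    have "y v \<le> real K * y u"
      using order_trans[OF near(1)[OF vu] mult_right_mono[OF K]] xy[OF V(1)] by simp
    then have "lv v \<le> Suc (lv u)" unfolding lv_def using xy V by (intro adic_level_le[OF K2]) auto
    moreover have "\<bar>s u - s v\<bar> \<le> real K ^ lv u" using near(2)[OF vu] by (simp add: abs_minus_commute)
    ultimately show ?thesis
      unfolding X_def
      using adic_bag_of_near_columns[OF K2 uv(2) _ col[OF V(1)] col[OF V(2)]] XN V N[OF V(2)]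
      by (simp add: X_def)
  qed
  show ?thesis
  proof (rule row_treewidth_le_layered_partition[OF G undirected_tree_adic_tree[OF K2, of N],
        where B = "adic_bag K" and part = X and L = L, unfolded pverts_adic_tree])
    show "finite (adic_bag K t) \<and> card (adic_bag K t) \<le> Suc K" for t
      by (rule adic_bag_card[OF K2])
    show "conn (parcs (adic_tree K N)) {t \<in> adic_nodes K N. z \<in> adic_bag K t}"
      if "z \<in> (\<Union>t\<in>adic_nodes K N. adic_bag K t)" for z
      using that by (rule conn_adic_bags[OF K2])
    show "X ` pverts G \<subseteq> (\<Union>t\<in>adic_nodes K N. adic_bag K t)"
    proof (rule image_subsetI)
      fix v assume "v \<in> pverts G"
      have "K ^ N = K ^ (N - lv v) * K ^ lv v" using N[OF \<open>v \<in> _\<close>] by (simp flip: power_add)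
      then have "col v < K ^ (N - lv v)" using XN[OF \<open>v \<in> _\<close>] by (simp add: X_def)
      then have "prod_encode (lv v, col v) \<in> adic_nodes K N" using N[OF \<open>v \<in> _\<close>] by simp
      moreover have "X v \<in> adic_bag K (prod_encode (lv v, col v))"
        by (simp add: X_def le_imp_power_dvd dvd_mult)
      ultimately show "X v \<in> (\<Union>t\<in>adic_nodes K N. adic_bag K t)" by blast
    qed
  next
    fix u v assume uv: "(u, v) \<in> parcs G"
    then have V: "u \<in> pverts G" "v \<in> pverts G" using subG by auto
    have "ln (y u) \<le> ln (exp (2 * r) * y v)" using near(1)[OF uv] xy V by (intro ln_mono) (auto intro: less_le_trans[of _ 1])
    also have "\<dots> = 2 * r + ln (y v)" using xy[OF V(2)] by (simp add: ln_mult)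
    finally have "ln (y u) / (2 * r) \<le> ln (y v) / (2 * r) + 1" using r by (simp add: field_simps)
    moreover have "ln (y u) / (2 * r) \<ge> 0" "ln (y v) / (2 * r) \<ge> 0" using r xy V by (auto intro!: divide_nonneg_pos ln_ge_zero)
    ultimately have "L u \<le> Suc (L v)" unfolding L_def by linarith
    moreover have "\<exists>n\<in>adic_nodes K N. X u \<in> adic_bag K n \<and> X v \<in> adic_bag K n"
      using common_bag[OF uv] common_bag[of v u] symD[OF symG uv] nat_le_linear[of "lv u" "lv v"] by blast
    ultimately show "L u \<le> Suc (L v) \<and> (\<exists>t\<in>adic_nodes K N. X u \<in> adic_bag K t \<and> X v \<in> adic_bag K t)" ..
  next
    fix z l
    let ?A = "{v \<in> pverts G. X v = z \<and> L v = l}"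
    \<comment> \<open>A layer meets at most two consecutive levels, which the parity tells apart. Within one level, the
      columns are cut into \<open>Q\<close> pieces and the layers into two halves: points of one cell then differ
      by at most \<open>sinh (r/2) * K^i\<close> horizontally and by a factor of at most \<open>exp r\<close> vertically, and so
      are adjacent.\<close>
    define Q where "Q = 4 * K ^ 3"
    define sub where "sub v = (lv v mod 2, nat \<lfloor>(s v / real K ^ lv v - real (col v)) * real Q\<rfloor>,
       nat \<lfloor>ln (y v) / r\<rfloor> - 2 * l)" for v
    let ?I = "{..<2::nat} \<times> {..<Q} \<times> {..<2::nat}"
    have "card ?A \<le> card ?I * k"
    proof (rule card_le_card_fibres[where f = sub])
      show "finite ?I" by simp
      show "sub ` ?A \<subseteq> ?I"
      proof (rule image_subsetI)
        fix v assume "v \<in> ?A"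
        then have v: "v \<in> pverts G" "z = X v" "l = L v" by auto
        have "s v / real K ^ lv v < real (Suc (col v))"
          using col(2)[OF v(1)] Kpos by (simp only: pos_divide_less_eq)
        moreover have "Q > 0" using K2 by (simp add: Q_def)
        ultimately have "(s v / real K ^ lv v - real (col v)) * real Q < 1 * real Q"
          by (intro mult_strict_right_mono) auto
        then have "nat \<lfloor>(s v / real K ^ lv v - real (col v)) * real Q\<rfloor> < Q" 
          using \<open>Q > 0\<close> by linarith
        moreover have "ln (y v) / r = 2 * (ln (y v) / (2 * r))" by simp
        then have "nat \<lfloor>ln (y v) / r\<rfloor> - 2 * l < 2" unfolding v(3) L_def by linarith
        ultimately show "sub v \<in> ?I" by (simp add: sub_def v)
      qed
      fix i assume "i \<in> ?I"
      show "card {v \<in> ?A. sub v = i} \<le> k"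
      proof (rule order_trans[OF card_clique_le_clique_number[OF G] clique])
        show "{v \<in> ?A. sub v = i} \<subseteq> pverts G" by auto
        fix u v assume "u \<in> {v \<in> ?A. sub v = i}" "v \<in> {v \<in> ?A. sub v = i}" and "u \<noteq> v"
        then have V: "u \<in> pverts G" "v \<in> pverts G" and X: "X u = X v" and Luv: "L u = l" "L v = l" and sub: "sub u = sub v"
          by auto
        have pos: "y u \<ge> 1" "y v \<ge> 1" using xy V by auto
        have lnn: "ln (y u) \<ge> 0" "ln (y v) \<ge> 0" using pos by auto
        have lev: "lv a \<le> Suc (lv b)" if ab: "a \<in> pverts G" "b \<in> pverts G" "L a = L b" for a b
        proof -
          have ab1: "y a \<ge> 1" "y b \<ge> 1" using xy ab by auto
          have "ln (y a) / (2 * r) \<ge> 0" "ln (y b) / (2 * r) \<ge> 0" using ab1 r by auto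
          then have "ln (y a) / (2 * r) \<le> ln (y b) / (2 * r) + 1"
            using ab(3) unfolding L_def by linarith
          then have "ln (y a) \<le> 2 * r + ln (y b)" using r by (simp add: field_simps)
          then have "exp (ln (y a)) \<le> exp (2 * r + ln (y b))" by simp
          then have "y a \<le> exp (2 * r) * y b" using ab1 by (simp add: exp_add)
          also have "\<dots> \<le> real K * y b" using K ab1 by (intro mult_right_mono) auto
          finally show ?thesis unfolding lv_def by (intro adic_level_le[OF K2]) (use ab1 in auto)
        qed
        have "lv u \<le> Suc (lv v)" "lv v \<le> Suc (lv u)" using lev V Luv by auto
        moreover have "lv u mod 2 = lv v mod 2" using sub by (simp add: sub_def)
        ultimately have lvv: "lv u = lv v" by presburger
        define i where "i = lv v"
        have colv: "col u = col v" using X K2 by (simp add: X_def lvv)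
        have yi: "real K ^ i \<le> y u" "real K ^ i \<le> y v" using lv(1)[OF V(1)] lv(1)[OF V(2)] lvv by (simp_all add: i_def)
        define \<tau> where "\<tau> = sinh (r / 2)"
        have \<tau>: "\<tau> > 0" using r by (simp add: \<tau>_def)
        have "\<bar>(s u / real K ^ i - real (col v)) * real Q - (s v / real K ^ i - real (col v)) * real Q\<bar> \<le> 1"
        proof -
          have "s u / real K ^ i - real (col v) \<ge> 0" "s v / real K ^ i - real (col v) \<ge> 0"
            using col(1)[OF V(1)] col(1)[OF V(2)] Kpos unfolding lvv colv i_def[symmetric]
            by (simp_all add: pos_le_divide_eq)
          then have "(s u / real K ^ i - real (col v)) * real Q \<ge> 0" "(s v / real K ^ i - real (col v)) * real Q \<ge> 0"
            by auto
          moreover have "nat \<lfloor>(s u / real K ^ i - real (col v)) * real Q\<rfloor> = nat \<lfloor>(s v / real K ^ i - real (col v)) * real Q\<rfloor>"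
            using sub by (simp add: sub_def lvv colv i_def)
          ultimately show ?thesis by linarith
        qed
        also have "(s u / real K ^ i - real (col v)) * real Q - (s v / real K ^ i - real (col v)) * real Q
            = (x u - x v) * (real Q / (w * real K ^ i))"
          using w Kpos[of i] by (simp add: s_def field_simps)
        finally have "\<bar>x u - x v\<bar> * (real Q / (w * real K ^ i)) \<le> 1"
          using w Kpos[of i] by (simp add: abs_mult)
        then have "\<bar>x u - x v\<bar> * real Q \<le> w * real K ^ i"
          using w Kpos[of i] by (simp add: field_simps)
        moreover have "w \<le> real Q * \<tau>"
        proof -
          have "\<sigma> = 4 * \<tau> * cosh (r / 2)" using sinh_double[of "r / 2"] by (simp add: \<sigma>_def \<tau>_def)
          moreover have "cosh (r / 2) \<le> real K"
          proof -
            define E where "E = exp (2 * r)"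
            have "exp (- (r / 2)) \<le> E" "exp (r / 2) \<le> E" using r by (simp_all add: E_def)
            then have "cosh (r / 2) \<le> exp (2 * r)" unfolding cosh_field_def E_def[symmetric] by simp
            then show ?thesis using K by linarith
          qed
          ultimately have "\<sigma> \<le> 4 * \<tau> * real K" using \<tau> by (simp add: mult_left_mono)
          then have "w \<le> 4 * \<tau> * real K * (real K)\<^sup>2" unfolding w_def by (simp add: mult_right_mono)
          then show ?thesis by (simp add: Q_def power2_eq_square power3_eq_cube mult_ac)
        qed
        ultimately have "real Q * \<bar>x u - x v\<bar> \<le> real Q * (\<tau> * real K ^ i)"
          using order_trans[OF _ mult_right_mono[of w "real Q * \<tau>" "real K ^ i"]] Kpos[of i]
          by (simp add: mult_ac less_imp_le)
        then have "\<bar>x u - x v\<bar> \<le> \<tau> * real K ^ i" using K2 by (simp add: Q_def)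
        then have "\<bar>x u - x v\<bar>\<^sup>2 \<le> (\<tau> * real K ^ i)\<^sup>2" by (intro power_mono) auto
        then have "(x u - x v)\<^sup>2 \<le> (\<tau> * real K ^ i)\<^sup>2" by simp
        also have "\<dots> = \<tau>\<^sup>2 * (real K ^ i * real K ^ i)" by (simp add: power2_eq_square mult_ac)
        also have "\<dots> \<le> \<tau>\<^sup>2 * (y u * y v)"
          using yi Kpos[of i] pos by (intro mult_left_mono mult_mono) auto
        finally have dx: "(x u - x v)\<^sup>2 \<le> \<tau>\<^sup>2 * (y u * y v)" .
        have half: "y a \<le> exp r * y b" if ab: "a \<in> {u, v}" "b \<in> {u, v}" for a b
        proof -
          have ab1: "y a \<ge> 1" "y b \<ge> 1" using pos ab by auto
          have eq: "nat \<lfloor>ln (y u) / r\<rfloor> - 2 * l = nat \<lfloor>ln (y v) / r\<rfloor> - 2 * l"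
            using sub by (simp add: sub_def)
          have dbl: "ln (y u) / r = 2 * (ln (y u) / (2 * r))" "ln (y v) / r = 2 * (ln (y v) / (2 * r))" by simp_all
          have nn: "ln (y u) / (2 * r) \<ge> 0" "ln (y v) / (2 * r) \<ge> 0" using r lnn by auto
          have "2 * l \<le> nat \<lfloor>ln (y u) / r\<rfloor>" "2 * l \<le> nat \<lfloor>ln (y v) / r\<rfloor>"
            using nn Luv unfolding dbl L_def by linarith+
          then have "nat \<lfloor>ln (y u) / r\<rfloor> = nat \<lfloor>ln (y v) / r\<rfloor>" using eq by linarith
          moreover have "ln (y u) / r \<ge> 0" "ln (y v) / r \<ge> 0" using r lnn by auto
          ultimately have "\<bar>ln (y u) / r - ln (y v) / r\<bar> \<le> 1" by linarith
          then have "ln (y a) / r \<le> 1 + ln (y b) / r" using ab by auto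
          then have "ln (y a) \<le> r + ln (y b)" using r by (simp add: field_simps)
          then have "exp (ln (y a)) \<le> exp (r + ln (y b))" by simp
          then show ?thesis using ab1 by (simp add: exp_add)
        qed
        have dy: "(y u - y v)\<^sup>2 \<le> 4 * \<tau>\<^sup>2 * (y u * y v)"
          unfolding \<tau>_def using pos r half[of u v] half[of v u] by (subst sq_diff_le_sinh_iff) auto
        have "(x u - x v)\<^sup>2 + (y u - y v)\<^sup>2 \<le> 5 * \<tau>\<^sup>2 * (y u * y v)" using dx dy by simp
        also have "\<dots> \<le> 4 * (sinh r)\<^sup>2 * (y u * y v)"
        proof (rule mult_right_mono)
          have "sinh r = 2 * \<tau> * cosh (r / 2)" using sinh_double[of "r / 2"] by (simp add: \<tau>_def)
          moreover have "2 * \<tau> * 1 \<le> 2 * \<tau> * cosh (r / 2)" using \<tau> cosh_real_ge_1[of "r / 2"] by (intro mult_left_mono) auto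
          ultimately have "2 * \<tau> \<le> sinh r" by simp
          then have "(2 * \<tau>)\<^sup>2 \<le> (sinh r)\<^sup>2" using \<tau> by (intro power_mono) auto
          then have "4 * \<tau>\<^sup>2 \<le> (sinh r)\<^sup>2" by (simp add: power_mult_distrib)
          then show "5 * \<tau>\<^sup>2 \<le> 4 * (sinh r)\<^sup>2" using zero_le_power2[of \<tau>] by linarith
        qed (use pos in auto)
        finally show "(u, v) \<in> parcs G" using adj[OF V \<open>u \<noteq> v\<close>] by simp
      qed
    qed
    also have "card ?I * k = 16 * K ^ 3 * k" by (simp add: Q_def)
    finally show "card ?A \<le> 16 * K ^ 3 * k" .
  qed
qed

text \<open>
  Translations and dilations of the half-plane are isometries, so the lowest height can be scaled
  to \<open>1\<close> and the leftmost abscissa moved to \<open>0\<close>.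
\<close>
lemma row_treewidth_hudg_le:
  assumes hudg: "hudg r G" and r: "r \<le> R" and K: "exp (2 * R) \<le> real K" and clique: "clique_number G \<le> k"
  shows "row_treewidth G \<le> Suc K * (16 * K ^ 3 * k)"
proof (cases "pverts G = {}")
  case True
  have "pair_graph G" using hudg by (simp add: hudg_def)
  then have "row_treewidth G \<le> card (pverts G)"
    using row_treewidth_le_card row_treewidth_le by (meson le_trans)
  then show ?thesis using True by simp
next
  case False
  have G: "pair_graph G" and "r > 0" using hudg by (auto simp: hudg_def)
  obtain p where p: "\<And>v. v \<in> pverts G \<Longrightarrow> Im (p v) > 0"
    and adj: "\<And>u v. u \<in> pverts G \<Longrightarrow> v \<in> pverts G \<Longrightarrow> u \<noteq> v \<Longrightarrow>
      (u, v) \<in> parcs G \<longleftrightarrow> hyp_dist (p u) (p v) \<le> 2 * r"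
    using hudg unfolding hudg_def upper_half_plane_def by auto
  have fin: "finite (pverts G)" using G by (simp add: pair_graph_iff)
  define b where "b = Min ((\<lambda>v. Re (p v)) ` pverts G)"
  define l where "l = Min ((\<lambda>v. Im (p v)) ` pverts G)"
  have b: "b \<le> Re (p v)" and l: "l \<le> Im (p v)" if "v \<in> pverts G" for v
    using fin that by (auto simp: b_def l_def)
  have "l \<in> (\<lambda>v. Im (p v)) ` pverts G" unfolding l_def using fin False by (intro Min_in) auto
  then have "l > 0" using p by auto
  define x where "x v = (Re (p v) - b) / l" for v
  define y where "y v = Im (p v) / l" for v
  show ?thesis
  proof (rule row_treewidth_half_plane_le[OF G False \<open>r > 0\<close> _ _ _ clique])
    show "exp (2 * r) \<le> real K" using r K by (meson exp_le_cancel_iff mult_left_mono order_trans zero_le_numeral)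
    show "x v \<ge> 0 \<and> y v \<ge> 1" if "v \<in> pverts G" for v
      using b[OF that] l[OF that] \<open>l > 0\<close> by (simp add: x_def y_def)
    fix u v assume uv: "u \<in> pverts G" "v \<in> pverts G" "u \<noteq> v"
    have "(u, v) \<in> parcs G \<longleftrightarrow> (Re (p u) - Re (p v))\<^sup>2 + (Im (p u) - Im (p v))\<^sup>2
        \<le> 4 * (sinh r)\<^sup>2 * (Im (p u) * Im (p v))"
      using adj[OF uv] hyp_dist_le_iff p uv \<open>r > 0\<close> by simp
    also have "\<dots> \<longleftrightarrow> l\<^sup>2 * ((x u - x v)\<^sup>2 + (y u - y v)\<^sup>2) \<le> l\<^sup>2 * (4 * (sinh r)\<^sup>2 * (y u * y v))"
    proof -
      have "Re (p u) - Re (p v) = l * (x u - x v)" "Im (p u) - Im (p v) = l * (y u - y v)"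
        and im: "Im (p u) = l * y u" "Im (p v) = l * y v"
        using \<open>l > 0\<close> by (simp_all add: x_def y_def flip: diff_divide_distrib)
      then have "(Re (p u) - Re (p v))\<^sup>2 + (Im (p u) - Im (p v))\<^sup>2 = l\<^sup>2 * ((x u - x v)\<^sup>2 + (y u - y v)\<^sup>2)"
        by (simp only: power_mult_distrib distrib_left)
      moreover have "4 * (sinh r)\<^sup>2 * (Im (p u) * Im (p v)) = l\<^sup>2 * (4 * (sinh r)\<^sup>2 * (y u * y v))"
        unfolding im by (simp add: power2_eq_square mult_ac)
      ultimately show ?thesis by (simp only:)
    qed
    also have "\<dots> \<longleftrightarrow> (x u - x v)\<^sup>2 + (y u - y v)\<^sup>2 \<le> 4 * (sinh r)\<^sup>2 * (y u * y v)"
      using \<open>l > 0\<close> by (intro mult_le_cancel_left_pos) simp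
    finally show "(u, v) \<in> parcs G \<longleftrightarrow> (x u - x v)\<^sup>2 + (y u - y v)\<^sup>2 \<le> 4 * (sinh r)\<^sup>2 * (y u * y v)" .
  qed
qed

lemma bounded_hudg_family_admits_product_structure:
  assumes "hudg_family \<G>" "clique_number_O (\<lambda>_. 1) \<G>" "disk_radius_O (\<lambda>_. 1) \<G>"
  shows "admits_product_structure \<G>"
proof -
  obtain k N1 where k: "\<And>G. G \<in> \<G> \<Longrightarrow> card (pverts G) \<ge> N1 \<Longrightarrow> real (clique_number G) \<le> k"
    using assms(2) unfolding clique_number_O_def eventually_sequentially by auto
  obtain R N2 where "\<forall>n\<ge>N2. \<forall>G\<in>\<G>. card (pverts G) = n \<longrightarrow> (\<exists>r. hudg r G \<and> r \<le> R * 1)"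
    using assms(3) unfolding disk_radius_O_def eventually_sequentially by blast
  then have R: "\<exists>r. hudg r G \<and> r \<le> R" if "G \<in> \<G>" "card (pverts G) \<ge> N2" for G
    using that by simp
  define K where "K = nat \<lceil>exp (2 * R)\<rceil>"
  define C where "C = Suc K * (16 * K ^ 3 * nat \<lceil>k\<rceil>)"
  have "row_treewidth G \<le> max (max N1 N2) C" if G: "G \<in> \<G>" for G
  proof (cases "card (pverts G) \<ge> max N1 N2")
    case True
    then obtain r where "hudg r G" "r \<le> R" using R[OF G] by auto
    moreover have "exp (2 * R) \<le> real K" unfolding K_def by (rule real_nat_ceiling_ge)
    moreover have "clique_number G \<le> nat \<lceil>k\<rceil>" using k[OF G] True by (simp add: le_nat_iff ceiling_mono le_ceiling_iff)
    ultimately show ?thesis unfolding C_def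
      using row_treewidth_hudg_le by (meson max.coboundedI2)
  next
    case False
    have "pair_graph G" using assms(1) G unfolding hudg_family_def hudg_def by blast
    then have "row_treewidth G \<le> card (pverts G)"
      using row_treewidth_le_card row_treewidth_le by (meson le_trans)
    then show ?thesis using False by linarith
  qed
  then show ?thesis unfolding admits_product_structure_def by blast
qed

section \<open>Nested rows of points\<close>

text \<open>
  The numbers \<open>d k\<close> of the introduction. The exponents \<open>3^M - 3^k\<close> are strictly concave in \<open>k\<close>, which
  makes the inequality \<open>half_gap_convex\<close> possible; the last row \<open>M\<close> has \<open>d M = 1\<close>.
\<close>
definition half_gap :: "nat \<Rightarrow> nat \<Rightarrow> nat" where
  "half_gap M k = 4 ^ (3 ^ M - 3 ^ k)"

text \<open>Length of the interval that carries the \<open>M\<close> points of row \<open>0\<close>.\<close>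
definition width :: "nat \<Rightarrow> nat" where
  "width M = 2 * M * half_gap M 0"

text \<open>
  The vertex \<open>(k, b)\<close> is point \<open>b\<close> of row \<open>k\<close> if \<open>k \<le> M\<close>; vertices beyond row \<open>M\<close> are placed like the apex.
\<close>
definition abscissa :: "nat \<Rightarrow> nat \<Rightarrow> real" where
  "abscissa M v = (case prod_decode v of (k, b) \<Rightarrow> if k \<le> M then real ((2 * b + 1) * half_gap M k) else 0)"

text \<open>
  The height of a vertex is its scale divided by \<open>q = 2 sinh r\<close>. In these units \<open>hyp_dist_le_iff\<close>
  becomes the adjacency of \<open>nested_rows_graph\<close> below, where the radius enters only through the
  term \<open>((scale u - scale v) / q)^2\<close>, which is small for large \<open>q\<close>. The abscissae of consecutive
  points of row \<open>k\<close> differ by exactly \<open>2 * d k\<close>, the scale of that row. The scale of the apex is large enough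
  to reach even the lowest points of the core across the whole width.
\<close>
definition scale :: "nat \<Rightarrow> nat \<Rightarrow> real" where
  "scale M v = (case prod_decode v of (k, b) \<Rightarrow> if k \<le> M then real (2 * half_gap M k) else real (2 * (width M)\<^sup>2))"

definition apex :: "nat \<Rightarrow> nat" where
  "apex M = prod_encode (Suc M, 0)"

definition row :: "nat \<Rightarrow> nat \<Rightarrow> nat set" where
  "row M k = {prod_encode (k, b) | b. b < M * (half_gap M 0 div half_gap M k)}"

text \<open>
  A star: for \<open>k \<ge> 1\<close>, point \<open>j\<close> of row \<open>0\<close> is an even multiple of \<open>d k\<close>, and the chosen point of row \<open>k\<close>
  is the next odd multiple to its right.
\<close>
definition column :: "nat \<Rightarrow> nat \<Rightarrow> nat set" where
  "column M j = insert (prod_encode (0, j))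
     {prod_encode (k, (2 * j + 1) * (half_gap M 0 div (2 * half_gap M k))) | k. 1 \<le> k \<and> k < M}"

definition core :: "nat \<Rightarrow> nat set" where
  "core M = insert (apex M) (\<Union>k<M. row M k)"

text \<open>Extra points of row \<open>M\<close> bring the number of vertices to \<open>n\<close>; the core itself uses the rows below \<open>M\<close>.\<close>
definition padded_core :: "nat \<Rightarrow> nat \<Rightarrow> nat set" where
  "padded_core M n = core M \<union> (\<lambda>b. prod_encode (M, b)) ` {..<n - card (core M)}"

definition nested_rows_graph :: "nat \<Rightarrow> nat \<Rightarrow> real \<Rightarrow> nat pair_pre_digraph" where
  "nested_rows_graph M n q = \<lparr> pverts = padded_core M n,
     parcs = {(u, v). u \<in> padded_core M n \<and> v \<in> padded_core M n \<and> u \<noteq> v \<and>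
       (abscissa M u - abscissa M v)\<^sup>2 + ((scale M u - scale M v) / q)\<^sup>2 \<le> scale M u * scale M v} \<rparr>"

lemma abscissa_encode [simp]: "k \<le> M \<Longrightarrow> abscissa M (prod_encode (k, b)) = real ((2 * b + 1) * half_gap M k)"
  and scale_encode [simp]: "k \<le> M \<Longrightarrow> scale M (prod_encode (k, b)) = real (2 * half_gap M k)"
  and abscissa_apex [simp]: "abscissa M (apex M) = 0"
  and scale_apex [simp]: "scale M (apex M) = real (2 * (width M)\<^sup>2)"
  by (simp_all add: abscissa_def scale_def apex_def)

lemma encode_neq_apex [simp]: "k \<le> M \<Longrightarrow> prod_encode (k, b) \<noteq> apex M" 
  by (simp add: apex_def)

lemma half_gap_pos [simp]: "half_gap M k > 0"
  by (simp add: half_gap_def)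

lemma half_gap_neq_0 [simp]: "half_gap M k \<noteq> 0"
  by (simp add: half_gap_def)

lemma half_gap_split:
  assumes "i < j" "j \<le> M"
  shows "\<exists>e. half_gap M i = 2 * half_gap M j * e"
proof -
  have "(3::nat) ^ i < 3 ^ j" "(3::nat) ^ j \<le> 3 ^ M" using assms by simp_all
  then have "3 ^ M - 3 ^ i = Suc (3 ^ M - 3 ^ j + (3 ^ j - 3 ^ i - 1))" by linarith
  then have "half_gap M i = 4 ^ Suc (3 ^ M - 3 ^ j + (3 ^ j - 3 ^ i - 1))" by (simp only: half_gap_def)
  then have "half_gap M i = 2 * half_gap M j * (2 * 4 ^ (3 ^ j - 3 ^ i - 1))"
    by (simp add: half_gap_def power_add)
  then show ?thesis by blast
qed

lemma half_gap_mono: "i \<le> j \<Longrightarrow> j \<le> M \<Longrightarrow> half_gap M j \<le> half_gap M i"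
  by (simp add: half_gap_def diff_le_mono2)

text \<open>
  In the exponent of \<open>4\<close> this says \<open>2 + 2 * 3^j < 3^i + 3^l\<close>, which holds as \<open>3^l \<ge> 3 * 3^j\<close>, \<open>3^j \<ge> 3\<close> and \<open>3^i \<ge> 1\<close>.
\<close>
lemma half_gap_convex:
  assumes "i < j" "j < l" "l \<le> M"
  shows "16 * (half_gap M i * half_gap M l) < (half_gap M j)\<^sup>2"
proof -
  have 1: "(3::nat) ^ i < 3 ^ j" "(3::nat) ^ j < 3 ^ l" "(3::nat) ^ l \<le> 3 ^ M" using assms by simp_all
  have "(3::nat) ^ Suc j \<le> 3 ^ l" using assms by (intro power_increasing) auto
  then have 2: "3 * (3::nat) ^ j \<le> 3 ^ l" by simp
  have 3: "(3::nat) ^ j \<ge> 3 ^ 1" using assms by (intro power_increasing) auto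
  have "(1::nat) \<le> 3 ^ i" by simp
  then have "2 + (3 ^ M - 3 ^ i) + (3 ^ M - 3 ^ l) < (3 ^ M - 3 ^ j) + (3 ^ M - (3::nat) ^ j)"
    using 1 2 3 by linarith
  then have "(4::nat) ^ (2 + (3 ^ M - 3 ^ i) + (3 ^ M - 3 ^ l)) < 4 ^ ((3 ^ M - 3 ^ j) + (3 ^ M - 3 ^ j))"
    by (intro power_strict_increasing) auto
  then show ?thesis by (simp add: half_gap_def power_add power2_eq_square mult_ac)
qed

lemma finite_core: "finite (core M)"
proof -
  have "row M k = (\<lambda>b. prod_encode (k, b)) ` {..<M * (half_gap M 0 div half_gap M k)}" for k
    by (auto simp: row_def)
  then show ?thesis by (simp add: core_def)
qed

lemma finite_padded_core: "finite (padded_core M n)"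
  by (simp add: padded_core_def finite_core)

lemma card_padded_core:
  assumes "card (core M) \<le> n"
  shows "card (padded_core M n) = n"
proof -
  have "core M \<inter> (\<lambda>b. prod_encode (M, b)) ` {..<n - card (core M)} = {}"
    by (auto simp: core_def row_def apex_def)
  then have "card (padded_core M n) = card (core M) + card ((\<lambda>b. prod_encode (M, b)) ` {..<n - card (core M)})"
    unfolding padded_core_def by (intro card_Un_disjoint finite_core) auto
  also have "card ((\<lambda>b. prod_encode (M, b)) ` {..<n - card (core M)}) = n - card (core M)"
    by (subst card_image) (auto simp: inj_on_def)
  finally show ?thesis using assms by simp
qed

lemma padded_coreE:
  assumes "v \<in> padded_core M n" "v \<noteq> apex M"
  obtains k b where "v = prod_encode (k, b)" "k \<le> M"
  using assms by (auto simp: padded_core_def core_def row_def)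

lemma row_subset: "k < M \<Longrightarrow> row M k \<subseteq> padded_core M n"
  by (auto simp: padded_core_def core_def)

lemma column_subset_rows: "j < M \<Longrightarrow> column M j \<subseteq> (\<Union>k<M. row M k)"
  and row_meets_column: "j < M \<Longrightarrow> k < M \<Longrightarrow> row M k \<inter> column M j \<noteq> {}"
proof -
  have 0: "prod_encode (0, j) \<in> row M 0" if "j < M" using that by (simp add: row_def)
  have k: "prod_encode (k, (2 * j + 1) * (half_gap M 0 div (2 * half_gap M k))) \<in> row M k"
    if jk: "j < M" "1 \<le> k" "k < M" for k
  proof -
    obtain e where e: "half_gap M 0 = 2 * half_gap M k * e" using half_gap_split[of 0 k M] jk by auto
    have "e > 0" using e half_gap_pos[of M 0] by (metis mult_0_right gr0I less_irrefl)
    moreover have "half_gap M 0 div (2 * half_gap M k) = e" "half_gap M 0 div half_gap M k = 2 * e"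
      using e by (simp_all add: mult.assoc mult.left_commute[of 2])
    moreover have "(2 * j + 1) * e < M * (2 * e)"
      using jk(1) \<open>e > 0\<close> by (simp only: mult.assoc[symmetric] mult_less_cancel2) simp
    ultimately show ?thesis by (simp add: row_def)
  qed
  show "column M j \<subseteq> (\<Union>k<M. row M k)" if "j < M"
    using 0[OF that] k[OF that] that by (auto simp: column_def)
  show "row M k \<inter> column M j \<noteq> {}" if "j < M" "k < M"
  proof (cases "k = 0")
    case True
    then show ?thesis using 0[OF that(1)] by (auto simp: column_def)
  next
    case False
    let ?v = "prod_encode (k, (2 * j + 1) * (half_gap M 0 div (2 * half_gap M k)))"
    have "1 \<le> k" using False by simp
    then have "?v \<in> row M k" "?v \<in> column M j" using k that unfolding column_def by blast+
    then show ?thesis by blast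
  qed
qed

lemma pair_graph_nested_rows_graph: "pair_graph (nested_rows_graph M n q)"
  using finite_padded_core
  by (auto simp: pair_graph_iff nested_rows_graph_def sym_def irrefl_def power2_commute mult.commute power_divide)

lemma hudg_nested_rows_graph:
  assumes "M > 0" "r > 0"
  shows "hudg r (nested_rows_graph M n (2 * sinh r))"
proof -
  define q where "q = 2 * sinh r"
  have q: "q > 0" using assms by (simp add: q_def)
  define p where "p v = Complex (abscissa M v) (scale M v / q)" for v
  have "width M > 0" using assms by (simp add: width_def)
  then have "scale M v > 0" for v by (simp add: scale_def split: prod.split)
  then have pos: "Im (p v) > 0" for v using q by (simp add: p_def)
  have "hyp_dist (p u) (p v) \<le> 2 * r \<longleftrightarrow>
    (abscissa M u - abscissa M v)\<^sup>2 + ((scale M u - scale M v) / q)\<^sup>2 \<le> scale M u * scale M v" for u v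
  proof -
    have "4 * (sinh r)\<^sup>2 * (Im (p u) * Im (p v)) = scale M u * scale M v"
      using q by (simp add: p_def q_def power2_eq_square field_simps)
    then show ?thesis
      using hyp_dist_le_iff[OF pos pos, of r u v] assms(2) by (simp add: p_def diff_divide_distrib)
  qed
  then show ?thesis
    using assms(2) pair_graph_nested_rows_graph pos unfolding hudg_def q_def[symmetric]
    by (intro conjI exI[of _ p]) (auto simp: nested_rows_graph_def upper_half_plane_def)
qed

lemma three_elements_nat:
  fixes A :: "nat set"
  assumes "finite A" "3 \<le> card A"
  shows "\<exists>a\<in>A. \<exists>b\<in>A. \<exists>c\<in>A. a < b \<and> b < c"
proof -
  have ne: "A \<noteq> {}" using assms by auto
  have "card {Min A, Max A} \<le> 2" by (simp add: card_insert_if)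
  then have "\<not> A \<subseteq> {Min A, Max A}" using assms(2) card_mono[of "{Min A, Max A}" A] by force
  then obtain b where b: "b \<in> A" "b \<noteq> Min A" "b \<noteq> Max A" by blast
  then have "Min A < b" "b < Max A" using assms(1) by (simp_all add: order.strict_iff_order)
  then show ?thesis using b ne assms(1) by (meson Max_in Min_in)
qed

lemma arc_abscissae:
  assumes "(prod_encode (k, b), prod_encode (l, c)) \<in> parcs (nested_rows_graph M n q)" "k \<le> M" "l \<le> M"
  shows "((2 * real b + 1) * real (half_gap M k) - (2 * real c + 1) * real (half_gap M l))\<^sup>2
    \<le> 4 * (real (half_gap M k) * real (half_gap M l))" (is "?d\<^sup>2 \<le> ?R")
proof -
  have "?d = abscissa M (prod_encode (k, b)) - abscissa M (prod_encode (l, c))"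
    "?R = scale M (prod_encode (k, b)) * scale M (prod_encode (l, c))"
    using assms(2,3) by (simp_all add: distrib_right)
  moreover have "(abscissa M (prod_encode (k, b)) - abscissa M (prod_encode (l, c)))\<^sup>2 + z\<^sup>2
      \<le> scale M (prod_encode (k, b)) * scale M (prod_encode (l, c))"
    if "z = (scale M (prod_encode (k, b)) - scale M (prod_encode (l, c))) / q" for z
    using assms(1) that by (simp add: nested_rows_graph_def)
  ultimately show ?thesis by (smt (verit) zero_le_power2)
qed

lemma same_row_adjacent:
  assumes "(prod_encode (k, b), prod_encode (k, c)) \<in> parcs (nested_rows_graph M n q)" "k \<le> M" "b < c"
  shows "c = Suc b"
proof (rule ccontr)
  assume "c \<noteq> Suc b"
  then have "real c - real b \<ge> 2" using assms(3) by linarith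
  define d where "d = real (half_gap M k)"
  have d: "d > 0" by (simp add: d_def)
  have "((2 * real b + 1) * d - (2 * real c + 1) * d)\<^sup>2 \<le> 4 * (d * d)"
    using arc_abscissae[OF assms(1,2,2)] by (simp only: d_def)
  also have "((2 * real b + 1) * d - (2 * real c + 1) * d)\<^sup>2 = ((real c - real b) * (2 * d))\<^sup>2"
    by (simp add: power2_eq_square algebra_simps)
  also have "\<dots> = (real c - real b)\<^sup>2 * (2 * d)\<^sup>2" by (rule power_mult_distrib)
  also have "4 * (d * d) = 1 * (2 * d)\<^sup>2" by (simp add: power2_eq_square)
  finally have "(real c - real b)\<^sup>2 * (2 * d)\<^sup>2 \<le> 1 * (2 * d)\<^sup>2" .
  then have "(real c - real b)\<^sup>2 \<le> 1" using d by (simp add: mult_le_cancel_right)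
  moreover have "2\<^sup>2 \<le> (real c - real b)\<^sup>2" using \<open>real c - real b \<ge> 2\<close> by (intro power_mono) auto
  ultimately show False by simp
qed

text \<open>
  By the parallelogram law, two points that are close to a common neighbour in a much smaller row
  are close to each other: their squared distance is at most \<open>16 * d i * d l < (d j)^2\<close>.
\<close>
lemma three_rows_not_adjacent:
  fixes M n q
  defines "E \<equiv> parcs (nested_rows_graph M n q)"
  assumes "(prod_encode (i, a), prod_encode (l, c)) \<in> E" "(prod_encode (j, b), prod_encode (l, c)) \<in> E"
    and ij: "i < j" "j < l" "l \<le> M"
  shows False
proof -
  define D where "D k = real (half_gap M k)" for k
  define xi xj xl where "xi = (2 * real a + 1) * D i" and "xj = (2 * real b + 1) * D j" and "xl = (2 * real c + 1) * D l"
  have 1: "(xi - xl)\<^sup>2 \<le> 4 * (D i * D l)"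
    unfolding D_def xi_def xl_def by (rule arc_abscissae[OF assms(2)[unfolded E_def]]) (use ij in auto)
  have "(xj - xl)\<^sup>2 \<le> 4 * (D j * D l)"
    unfolding D_def xj_def xl_def by (rule arc_abscissae[OF assms(3)[unfolded E_def]]) (use ij in auto)
  moreover have "D j * D l \<le> D i * D l" 
    using half_gap_mono[of i j M] ij by (intro mult_right_mono) (auto simp: D_def)
  ultimately have 2: "(xj - xl)\<^sup>2 \<le> 4 * (D i * D l)" by simp
  have "(xi - xj)\<^sup>2 + (xi + xj - 2 * xl)\<^sup>2 = 2 * (xi - xl)\<^sup>2 + 2 * (xj - xl)\<^sup>2"
    by (simp add: power2_eq_square algebra_simps)
  then have "(xi - xj)\<^sup>2 \<le> 16 * (D i * D l)" using 1 2 zero_le_power2[of "xi + xj - 2 * xl"] by linarith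
  moreover have "16 * (D i * D l) < (D j)\<^sup>2"
  proof -
    have "real (16 * (half_gap M i * half_gap M l)) < real ((half_gap M j)\<^sup>2)"
      using half_gap_convex[OF ij] by (simp only: of_nat_less_iff)
    then show ?thesis by (simp add: D_def)
  qed
  moreover have "(D j)\<^sup>2 \<le> (xi - xj)\<^sup>2"
  proof -
    \<comment> \<open>The abscissae differ by an odd multiple of \<open>D j\<close>, as \<open>D i\<close> is an even one.\<close>
    obtain e where "half_gap M i = 2 * half_gap M j * e" using half_gap_split[of i j M] ij by auto
    then have "D i = 2 * D j * real e" by (simp add: D_def)
    then have "xi - xj = D j * of_int (2 * ((2 * int a + 1) * int e - int b) - 1)"
      by (simp add: xi_def xj_def algebra_simps)
    moreover define m where "m = 2 * ((2 * int a + 1) * int e - int b) - 1"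
    ultimately have "xi - xj = D j * of_int m" by simp
    moreover have "m \<noteq> 0" unfolding m_def by presburger
    then have "m\<^sup>2 \<ge> 1" by (simp add: int_one_le_iff_zero_less)
    then have "(1::real) \<le> (of_int m)\<^sup>2" by (metis of_int_1 of_int_le_iff of_int_power)
    ultimately show ?thesis using mult_left_mono[of 1 "(of_int m)\<^sup>2" "(D j)\<^sup>2"] by (simp add: power_mult_distrib)
  qed
  ultimately show False by linarith
qed

text \<open>Two points in each of two rows, and the apex.\<close>
lemma clique_number_nested_rows_graph: "clique_number (nested_rows_graph M n q) \<le> 5"
proof -
  let ?G = "nested_rows_graph M n q"
  have bound: "card C \<le> 5" if sub: "C \<subseteq> padded_core M n"
    and clique: "\<And>u v. u \<in> C \<Longrightarrow> v \<in> C \<Longrightarrow> u \<noteq> v \<Longrightarrow> (u, v) \<in> parcs ?G" for C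
  proof -
    have fin: "finite C" using finite_subset[OF sub finite_padded_core] .
    define C' where "C' = C - {apex M}"
    have fin': "finite C'" using fin by (simp add: C'_def)
    define lev where "lev v = fst (prod_decode v)" for v :: nat
    have dec: "\<exists>k b. v = prod_encode (k, b) \<and> k \<le> M" if "v \<in> C'" for v
    proof -
      have "v \<in> padded_core M n" "v \<noteq> apex M" using that sub by (auto simp: C'_def)
      then show ?thesis by (rule padded_coreE) auto
    qed
    have adj: "(prod_encode (i, a), prod_encode (j, b)) \<in> parcs ?G"
      if "prod_encode (i, a) \<in> C'" "prod_encode (j, b) \<in> C'" "(i, a) \<noteq> (j, b)" for i a j b
      using clique that by (auto simp: C'_def)
    have "card (lev ` C') \<le> 2"
    proof (rule ccontr)
      assume "\<not> ?thesis"
      then obtain u v w where uvw: "u \<in> C'" "v \<in> C'" "w \<in> C'" "lev u < lev v" "lev v < lev w"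
        using three_elements_nat[of "lev ` C'"] fin' by fastforce
      obtain i a j b l c where e: "u = prod_encode (i, a)" "v = prod_encode (j, b)" "w = prod_encode (l, c)" "l \<le> M"
        using dec uvw(1-3) by metis
      show False
        using three_rows_not_adjacent[of i a l c M n q j b] adj uvw e by (simp add: lev_def)
    qed
    moreover have "card {v \<in> C'. lev v = k} \<le> 2" for k
    proof (rule ccontr)
      define B where "B = {b. prod_encode (k, b) \<in> C'}"
      have *: "{v \<in> C'. lev v = k} = (\<lambda>b. prod_encode (k, b)) ` B"
        using dec by (fastforce simp: lev_def B_def)
      have inj: "inj_on (\<lambda>b. prod_encode (k, b)) B" by (auto simp: inj_on_def)
      assume "\<not> ?thesis"
      then have "3 \<le> card B" unfolding * card_image[OF inj] by simp
      moreover have "finite ((\<lambda>b. prod_encode (k, b)) ` B)" unfolding *[symmetric] using fin' by simp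
      then have "finite B" using inj by (rule finite_imageD)
      ultimately obtain a b c where abc: "a \<in> B" "b \<in> B" "c \<in> B" "a < b" "b < c"
        using three_elements_nat by blast
      have "k \<le> M" using dec abc(1) by (fastforce simp: B_def)
      have "b = Suc a" "c = Suc a"
        by (rule same_row_adjacent[OF adj]; use abc \<open>k \<le> M\<close> in \<open>simp add: B_def\<close>)+
      then show False using abc by simp
    qed
    ultimately have "card C' \<le> 2 * 2"
      using card_le_card_fibres[of "lev ` C'" lev C' 2] fin' by fastforce
    moreover have "card C \<le> Suc (card C')" 
      unfolding C'_def using diff_card_le_card_Diff[of "{apex M}" C] by simp
    ultimately show ?thesis by simp
  qed
  let ?A = "{k. \<exists>S. subgraph (with_proj S) (with_proj ?G) \<and> complete_digraph k (with_proj S)}"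
  have "k \<le> 5" if k: "k \<in> ?A" for k
  proof -
    obtain S where S: "subgraph (with_proj S) (with_proj ?G)" "complete_digraph k (with_proj S)" using k by blast
    then have "pverts S \<subseteq> padded_core M n" "parcs S \<subseteq> parcs ?G"
      by (auto simp: subgraph_def nested_rows_graph_def)
    moreover have "card (pverts S) = k" "parcs S = {(u, v). (u, v) \<in> pverts S \<times> pverts S \<and> u \<noteq> v}"
      using S(2) by (auto simp: complete_digraph_pair_def)
    ultimately show ?thesis using bound[of "pverts S"] by auto
  qed
  moreover have "0 \<in> ?A"
  proof -
    have "complete_digraph 0 (with_proj \<lparr> pverts = {} :: nat set, parcs = {} \<rparr>)"
      by (simp add: complete_digraph_pair_def)
    moreover have "subgraph (with_proj \<lparr> pverts = {} :: nat set, parcs = {} \<rparr>) (with_proj ?G)"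
      using pair_graph_nested_rows_graph[of M n q]
      by (auto simp: subgraph_def wf_digraph_wp_iff pair_wf_digraph_def pair_graph_iff)
    ultimately show ?thesis by blast
  qed
  moreover have "finite ?A" using calculation(1) by (meson finite_nat_set_iff_bounded_le)
  ultimately show ?thesis unfolding clique_number_def by (subst Max_le_iff) auto
qed

lemma conn_star:
  assumes "sym E" "c \<in> S" "\<And>x. x \<in> S \<Longrightarrow> x \<noteq> c \<Longrightarrow> (c, x) \<in> E"
  shows "conn E S"
proof (rule conn_symI[OF assms(1,2)])
  fix x assume "x \<in> S"
  then show "(x, c) \<in> (Restr E S)\<^sup>*"
    using assms by (cases "x = c") (auto intro!: r_into_rtrancl dest: symD)
qed

text \<open>
  Rows and columns are the grid. The bound on \<open>q\<close> keeps the height term of the adjacency small: at most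
  \<open>1\<close> between two rows and at most \<open>(width M)^2\<close> between the apex and a row.
\<close>
lemma row_treewidth_nested_rows_graph:
  assumes M: "M > 0" and q: "q \<ge> 2 * real (width M)"
  shows "M \<le> 3 * Suc (row_treewidth (nested_rows_graph M n q))"
proof -
  let ?G = "nested_rows_graph M n q"
  have G: "pair_graph ?G" by (rule pair_graph_nested_rows_graph)
  have sym: "sym (parcs ?G)" using G by (simp add: pair_graph_iff)
  define W where "W = real (width M)"
  define D where "D k = real (half_gap M k)" for k
  have D1: "D k \<ge> 1" for k using half_gap_pos[of M k] unfolding D_def by linarith
  have W: "W = 2 * real M * D 0" by (simp add: W_def D_def width_def)
  have "1 * D 0 \<le> real M * D 0" using M D1[of 0] by (intro mult_right_mono) auto
  then have WD: "2 * D 0 \<le> W" by (simp add: W)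
  have "W > 0" using WD D1[of 0] by linarith
  have q': "q \<ge> 2 * W" "q > 0" using q \<open>W > 0\<close> by (simp_all add: W_def)
  have D0: "D k \<le> D 0" if "k \<le> M" for k using half_gap_mono[of 0 k M] that by (simp add: D_def)
  have sqdiv: "(z / q)\<^sup>2 \<le> t\<^sup>2" if "\<bar>z\<bar> \<le> t * q" "t \<ge> 0" for z t
  proof -
    have "\<bar>z / q\<bar> \<le> t" using that q' by (simp add: abs_divide pos_divide_le_eq)
    then have "\<bar>z / q\<bar>\<^sup>2 \<le> t\<^sup>2" by (intro power_mono) auto
    then show ?thesis unfolding power2_abs .
  qed
  have vert: "v \<in> padded_core M n" if "v \<in> row M k" "k < M" for v k using row_subset that by blast
  have apexV: "apex M \<in> padded_core M n" by (simp add: padded_core_def core_def)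
  have apex_adj: "(apex M, v) \<in> parcs ?G" if vk: "v \<in> row M k" "k < M" for v k
  proof -
    obtain b where v: "v = prod_encode (k, b)" and b: "b < M * (half_gap M 0 div half_gap M k)"
      using vk(1) by (auto simp: row_def)
    have "(2 * b + 1) * half_gap M k \<le> (2 * (M * (half_gap M 0 div half_gap M k))) * half_gap M k"
      using b by (intro mult_le_mono1) linarith
    also have "\<dots> \<le> width M" by (simp add: width_def mult.assoc)
    finally have le: "(2 * b + 1) * half_gap M k \<le> width M" .
    have "abscissa M v = real ((2 * b + 1) * half_gap M k)"
      unfolding v using vk(2) by (intro abscissa_encode) simp
    then have x: "abscissa M v \<le> W" "abscissa M v \<ge> 0"
      unfolding W_def using of_nat_mono[OF le, where 'a = real] by simp_all
    have "(abscissa M (apex M) - abscissa M v)\<^sup>2 \<le> W\<^sup>2"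
      using x by (simp add: power_mono)
    moreover have "((scale M (apex M) - scale M v) / q)\<^sup>2 \<le> W\<^sup>2"
    proof (rule sqdiv)
      have "2 * D k \<le> W * 2" using D0[of k] vk(2) WD D1[of 0] by linarith
      also have "\<dots> \<le> W * (2 * W)" using \<open>W > 0\<close> WD D1[of 0] by (intro mult_left_mono) auto
      finally have "\<bar>2 * W\<^sup>2 - 2 * D k\<bar> \<le> 2 * W\<^sup>2" using D1[of k] by (simp add: power2_eq_square)
      also have "\<dots> \<le> W * q" using mult_left_mono[OF q'(1), of W] \<open>W > 0\<close> by (simp add: power2_eq_square)
      finally show "\<bar>scale M (apex M) - scale M v\<bar> \<le> W * q"
        using vk by (simp add: v W_def D_def)
    qed (use \<open>W > 0\<close> in simp)
    moreover have "2 * W\<^sup>2 \<le> scale M (apex M) * scale M v"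
    proof -
      have "2 * W\<^sup>2 * 1 \<le> 2 * W\<^sup>2 * (2 * D k)" using D1[of k] by (intro mult_left_mono) auto
      then show ?thesis using vk by (simp add: v W_def D_def)
    qed
    ultimately have "(abscissa M (apex M) - abscissa M v)\<^sup>2 + ((scale M (apex M) - scale M v) / q)\<^sup>2
        \<le> scale M (apex M) * scale M v" by linarith
    moreover have "apex M \<noteq> v" using vk encode_neq_apex[of k M b] by (metis v less_imp_le)
    ultimately show ?thesis using vert[OF vk] apexV by (simp add: nested_rows_graph_def)
  qed
  show ?thesis
  proof (rule grid_minor_with_apex_bounds_row_treewidth[OF G, where a = "apex M" and P = "row M" and Q = "column M"])
    fix i v assume "i < M" "v \<in> row M i \<union> column M i"
    then show "(apex M, v) \<in> parcs ?G" using apex_adj column_subset_rows by blast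
  next
    fix k assume k: "k < M"
    define N where "N = M * (half_gap M 0 div half_gap M k)"
    have "half_gap M k \<le> half_gap M 0" using half_gap_mono k by simp
    then have "N > 0" using M by (simp add: N_def div_greater_zero_iff)
    have mem: "prod_encode (k, b) \<in> row M k \<longleftrightarrow> b < N" for b by (auto simp: row_def N_def)
    have "conn (parcs ?G) (row M k)"
    proof (rule conn_symI[OF sym])
      show "prod_encode (k, 0) \<in> row M k" using \<open>N > 0\<close> by (simp add: mem)
      fix v assume "v \<in> row M k"
      then obtain b where v: "v = prod_encode (k, b)" "b < N" by (auto simp: row_def N_def)
      have "b < N \<Longrightarrow> (prod_encode (k, b), prod_encode (k, 0)) \<in> (Restr (parcs ?G) (row M k))\<^sup>*"
      proof (induction b)
        case (Suc b)
        have "abscissa M (prod_encode (k, Suc b)) - abscissa M (prod_encode (k, b)) = 2 * D k"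
          using k by (simp add: D_def algebra_simps)
        then have "(prod_encode (k, Suc b), prod_encode (k, b)) \<in> parcs ?G"
          using k vert[of _ k] mem Suc.prems by (simp add: nested_rows_graph_def D_def power2_eq_square)
        then show ?case
          using Suc mem by (intro converse_rtrancl_into_rtrancl[OF _ Suc.IH]) auto
      qed simp
      then show "(v, prod_encode (k, 0)) \<in> (Restr (parcs ?G) (row M k))\<^sup>*" using v by simp
    qed
    then show "conn (parcs ?G) (row M k) \<and> row M k \<subseteq> pverts ?G"
      using row_subset[OF k] by (simp add: nested_rows_graph_def)
  next
    show "disjoint_family_on (row M) {..<M}" by (auto simp: disjoint_family_on_def row_def)
  next
    fix j assume j: "j < M"
    have sub: "column M j \<subseteq> padded_core M n" using column_subset_rows[OF j] row_subset by blast
    have "conn (parcs ?G) (column M j)"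
    proof (rule conn_star[OF sym])
      show c: "prod_encode (0, j) \<in> column M j" by (simp add: column_def)
      fix v assume v: "v \<in> column M j" "v \<noteq> prod_encode (0, j)"
      then obtain k where k: "1 \<le> k" "k < M"
        and vk: "v = prod_encode (k, (2 * j + 1) * (half_gap M 0 div (2 * half_gap M k)))"
        by (auto simp: column_def)
      obtain e where e: "half_gap M 0 = 2 * half_gap M k * e" using half_gap_split[of 0 k M] k by auto
      then have vk: "v = prod_encode (k, (2 * j + 1) * e)" using vk by simp
      have e': "D 0 = 2 * D k * real e" using e by (simp add: D_def)
      have dx: "abscissa M (prod_encode (0, j)) - abscissa M v = - D k"
      proof -
        have "abscissa M (prod_encode (0, j)) = (2 * real j + 1) * D 0"
          "abscissa M v = (2 * ((2 * real j + 1) * real e) + 1) * D k"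
          using k by (simp_all add: vk D_def algebra_simps)
        then show ?thesis unfolding e' by (simp add: algebra_simps)
      qed
      have "((scale M (prod_encode (0, j)) - scale M v) / q)\<^sup>2 \<le> 1\<^sup>2"
      proof (rule sqdiv)
        have "\<bar>2 * D 0 - 2 * D k\<bar> \<le> 1 * q" using D0[of k] k D1[of k] q'(1) WD by linarith
        then show "\<bar>scale M (prod_encode (0, j)) - scale M v\<bar> \<le> 1 * q" using k by (simp add: vk D_def)
      qed simp
      moreover have "1 \<le> (D k)\<^sup>2" using D1[of k] by simp
      moreover have "(D k)\<^sup>2 \<le> D 0 * D k" using D0[of k] D1[of k] k unfolding power2_eq_square by (intro mult_right_mono) auto
      moreover have "scale M (prod_encode (0, j)) * scale M v = 4 * (D 0 * D k)" using k by (simp add: vk D_def)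
      ultimately have "(abscissa M (prod_encode (0, j)) - abscissa M v)\<^sup>2 + ((scale M (prod_encode (0, j)) - scale M v) / q)\<^sup>2
          \<le> scale M (prod_encode (0, j)) * scale M v" unfolding dx power2_minus power_one by linarith
      then show "(prod_encode (0, j), v) \<in> parcs ?G"
        using v c sub by (auto simp: nested_rows_graph_def)
    qed
    then show "conn (parcs ?G) (column M j) \<and> column M j \<subseteq> pverts ?G"
      using sub by (simp add: nested_rows_graph_def)
  next
    show "disjoint_family_on (column M) {..<M}"
      unfolding disjoint_family_on_def
    proof (intro ballI impI)
      fix j j' :: nat assume "j \<noteq> j'"
      have nz: "half_gap M 0 div (2 * half_gap M k) \<noteq> 0" if k: "1 \<le> k" "k < M" for k
      proof -
        obtain e where e: "half_gap M 0 = 2 * half_gap M k * e" using half_gap_split[of 0 k M] k by auto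
        then have "e > 0" using half_gap_pos[of M 0] by (metis mult_0_right gr0I less_irrefl)
        then show ?thesis using e by simp
      qed
      show "column M j \<inter> column M j' = {}" using \<open>j \<noteq> j'\<close> by (auto simp: column_def nz)
    qed
  next
    fix i j assume "i < M" "j < M"
    then show "row M i \<inter> column M j \<noteq> {}" using row_meets_column by blast
  qed
qed

text \<open>
  For each number \<open>M\<close> of rows, the order \<open>n M\<close> is chosen so large that the core fits and \<open>r (n M)\<close> exceeds the
  radius that the grid needs. The disk radius is then exactly \<open>r (n M)\<close>.
\<close>
lemma unbounded_radius_hudg_family_without_product_structure:
  fixes r :: "nat \<Rightarrow> real"
  assumes "filterlim r at_top sequentially"
  shows "\<exists>\<G> :: nat pair_pre_digraph set. hudg_family \<G> \<and> clique_number_O (\<lambda>_. 1) \<G> \<and>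
    disk_radius_Theta r \<G> \<and> \<not> admits_product_structure \<G>"
proof -
  have "\<exists>n. card (core M) \<le> n \<and> 1 \<le> r n \<and> 2 * real (width M) \<le> r n" for M
  proof -
    have "\<forall>\<^sub>F n in sequentially. max 1 (2 * real (width M)) \<le> r n"
      using assms unfolding filterlim_at_top by blast
    then have "\<forall>\<^sub>F n in sequentially. max 1 (2 * real (width M)) \<le> r n \<and> card (core M) \<le> n"
      using eventually_ge_at_top by (rule eventually_conj)
    from eventually_happens[OF this] show ?thesis by auto
  qed
  then obtain n where n: "\<And>M. card (core M) \<le> n M" "\<And>M. 1 \<le> r (n M)" "\<And>M. 2 * real (width M) \<le> r (n M)"
    by metis
  have q: "2 * real (width M) \<le> 2 * sinh (r (n M))" for M
  proof -
    have "1 + r (n M) \<le> exp (r (n M))" by (rule exp_ge_add_one_self)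
    moreover have "exp (- r (n M)) \<le> 1" using n(2)[of M] by simp
    moreover have "2 * sinh (r (n M)) = exp (r (n M)) - exp (- r (n M))" by (simp add: sinh_field_def)
    ultimately show ?thesis using n(3)[of M] by linarith
  qed
  define \<G> where "\<G> = {nested_rows_graph M (n M) (2 * sinh (r (n M))) | M. M > 0}"
  have card: "card (pverts (nested_rows_graph M (n M) q)) = n M" for M q
    using card_padded_core[OF n(1)] by (simp add: nested_rows_graph_def)
  have hudg: "hudg (r (card (pverts G))) G" if "G \<in> \<G>" for G
  proof -
    obtain M where M: "M > 0" "G = nested_rows_graph M (n M) (2 * sinh (r (n M)))"
      using \<open>G \<in> \<G>\<close> by (auto simp: \<G>_def)
    have "0 < r (n M)" using n(2)[of M] by simp
    then show ?thesis using hudg_nested_rows_graph[OF M(1)] by (simp add: M(2) card)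
  qed
  have "hudg_family \<G>" using hudg unfolding hudg_family_def by blast
  moreover have "clique_number_O (\<lambda>_. 1) \<G>"
    unfolding clique_number_O_def
  proof (intro exI[of _ 5] conjI always_eventually allI ballI impI)
    fix G assume "G \<in> \<G>"
    then have "clique_number G \<le> 5" using clique_number_nested_rows_graph by (auto simp: \<G>_def)
    then show "real (clique_number G) \<le> 5 * 1" by simp
  qed simp
  moreover have "disk_radius_Theta r \<G>"
  proof -
    have "\<forall>\<^sub>F n in sequentially. \<forall>G\<in>\<G>. card (pverts G) = n \<longrightarrow>
        (\<exists>\<rho>. hudg \<rho> G \<and> 1 * r n \<le> \<rho> \<and> \<rho> \<le> 1 * r n)"
      using hudg by (intro always_eventually) auto
    then show ?thesis unfolding disk_radius_Theta_def using zero_less_one by blast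
  qed
  moreover have "\<not> admits_product_structure \<G>"
  proof
    assume "admits_product_structure \<G>"
    then obtain c where c: "\<And>G. G \<in> \<G> \<Longrightarrow> row_treewidth G \<le> c" by (auto simp: admits_product_structure_def)
    define M where "M = 3 * Suc c + 1"
    have "M \<le> 3 * Suc (row_treewidth (nested_rows_graph M (n M) (2 * sinh (r (n M)))))"
      by (rule row_treewidth_nested_rows_graph[OF _ q]) (simp add: M_def)
    moreover have "row_treewidth (nested_rows_graph M (n M) (2 * sinh (r (n M)))) \<le> c"
      by (rule c) (auto simp: \<G>_def M_def)
    ultimately show False by (simp add: M_def)
  qed
  ultimately show ?thesis by blast
qed

theorem theorem2:
  shows "(\<forall>\<G> :: 'a pair_pre_digraph set.
            hudg_family \<G> \<and> clique_number_O (\<lambda>_. 1) \<G> \<and> disk_radius_O (\<lambda>_. 1) \<G> \<longrightarrow>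
            admits_product_structure \<G>) \<and>
         (\<forall>r :: nat \<Rightarrow> real. filterlim r at_top sequentially \<longrightarrow>
            (\<exists>\<G> :: nat pair_pre_digraph set.
               hudg_family \<G> \<and> clique_number_O (\<lambda>_. 1) \<G> \<and> disk_radius_Theta r \<G> \<and>
               \<not> admits_product_structure \<G>))"
  using bounded_hudg_family_admits_product_structure
    unbounded_radius_hudg_family_without_product_structure by blast

end
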